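(* Let $\alpha\ge 1$ and $q\in\mathbb{G}_\alpha$. The exponential map $\exp_q : T^*_q(\mathbb{G}_\alpha) \to \mathbb{G}_\alpha$ fails to be injective in any neighbourhood of any conjugate covector $\lambda_0 \in \mathrm{Conj}_q(\mathbb{G}_\alpha)$.
   Context: For $\alpha \geq 1$, the $\alpha$-Grushin plane $\mathbb{G}_\alpha$ is the sub-Riemannian structure on $\mathbb{R}^2$ generated by the vector fields $X = \partial_x$ and $Y_\alpha = |x|^\alpha \partial_y$. Its Hamiltonian is $H(x,y,u\,dx+v\,dy) = \frac12(u^2 + v^2 |x|^{2\alpha})$. For $q=(x_0,y_0)$ and $\lambda_0 = u_0\,dx|_q + v_0\,dy|_q$, the normal extremal with initial condition $(q,\lambda_0)$ is the solution of $\dot u = -\alpha v^2 |x|^{2(\alpha-1)} x$, $\dot v = 0$, $\dot x = u$, $\dot y = v|x|^{2\alpha}$ with initial values $(u_0,v_0,x_0,y_0)$; it exists for all times. The exponential map is $\exp_q(\lambda_0) = (x(1),y(1))$. The conjugate locus is $\mathrm{Conj}_q(\mathbb{G}_\alpha)=\{\lambda_0\in T^*_q(\mathbb{G}_\alpha) : \mathrm{Ker}(d_{\lambda_0}\exp_q)\neq\{0\}\}$, and its elements are called conjugate covectors. *)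

theory Defs
  imports "HOL-Analysis.Analysis"
begin

text \<open>
  Points of the plane are pairs \<open>(x, y)\<close>, and \<open>(u, v)\<close> stands for the covector
  \<open>u dx + v dy\<close> at a given base point, so that each cotangent space is identified with
  \<open>real \<times> real\<close>.  Throughout, \<open>\<alpha> \<ge> 1\<close> is intended.

  The library sets \<open>0 powr a = 0\<close> for every \<open>a\<close>, including \<open>a = 0\<close>.  This is harmless below:
  \<open>\<bar>x\<bar> powr (2 * (\<alpha> - 1))\<close> is always multiplied by \<open>x\<close>, and \<open>2 * \<alpha> > 0\<close>.
\<close>

definition grushin_normal_extremal ::
  "real \<Rightarrow> real \<times> real \<Rightarrow> real \<times> real \<Rightarrow>
   (real \<Rightarrow> real) \<Rightarrow> (real \<Rightarrow> real) \<Rightarrow> (real \<Rightarrow> real) \<Rightarrow> (real \<Rightarrow> real) \<Rightarrow> bool"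
where
  "grushin_normal_extremal \<alpha> q l u v x y \<longleftrightarrow>
     (u 0, v 0) = l \<and> (x 0, y 0) = q \<and>
     (\<forall>t. (u has_real_derivative - \<alpha> * (v t)\<^sup>2 * \<bar>x t\<bar> powr (2 * (\<alpha> - 1)) * x t) (at t)) \<and>
     (\<forall>t. (v has_real_derivative 0) (at t)) \<and>
     (\<forall>t. (x has_real_derivative u t) (at t)) \<and>
     (\<forall>t. (y has_real_derivative v t * \<bar>x t\<bar> powr (2 * \<alpha>)) (at t))"

text \<open>
  For \<open>\<alpha> \<ge> 1\<close> the right-hand side of the system is continuously differentiable and the solution
  exists for all times, so the description below is proper and the exponential map is
  continuously differentiable; hence \<open>frechet_derivative\<close> is its true differential.
\<close>

definition grushin_exp :: "real \<Rightarrow> real \<times> real \<Rightarrow> real \<times> real \<Rightarrow> real \<times> real" where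
  "grushin_exp \<alpha> q l =
     (THE p. \<exists>u v x y. grushin_normal_extremal \<alpha> q l u v x y \<and> p = (x 1, y 1))"

definition grushin_conj :: "real \<Rightarrow> real \<times> real \<Rightarrow> (real \<times> real) set" where
  "grushin_conj \<alpha> q =
     {l. {w. frechet_derivative (grushin_exp \<alpha> q) (at l) w = 0} \<noteq> {0}}"

end

theory Submission
  imports Defs
begin

text \<open>
  The covector component \<open>v\<close> is constant, so an extremal is a solution of
  \<open>x'' = - \<alpha> v\<^sup>2 \<bar>x\<bar>\<^sup>2\<^sup>\<alpha>\<^sup>-\<^sup>2 x\<close> together with the quadrature for \<open>y\<close>.  If \<open>x\<close> solves this equation then
  so does \<open>a x(s + w t)\<close>, with \<open>v w a\<^sup>1\<^sup>-\<^sup>\<alpha>\<close> in place of \<open>v\<close>; hence all extremals with \<open>v \<noteq> 0\<close> near a given one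
  arise from it by dilations and time shifts, and the exponential map becomes explicit.

  Along the level curves of the first coordinate of the endpoint, parametrised by the dilation \<open>a\<close>,
  the second coordinate has derivative proportional at \<open>a = 1\<close> to the difference of \<open>t - x(t) / u(t)\<close> between the
  end time and the start time.  At a conjugate covector this difference vanishes, and since \<open>t - x / u\<close> is
  strictly decreasing, it changes sign as the level varies.  If the exponential
  map were injective, the second coordinate would be strictly monotone on every level curve,
  increasing on one side and decreasing on the other, and hence constant on the limiting level curve.
  The remaining conjugate covectors are those with \<open>u = 0\<close> at both ends, where the time reflection
  about the start yields two extremals with the same endpoint, and those with vanishing
  Hamiltonian, for which the extremals do not move.
\<close>

section \<open>Powers of the absolute value\<close>

text \<open>Away from 0 this is the power rule on either half-line. At 0 the difference quotient is
  \<open>\<bar>h\<bar> powr p\<close>, which tends to 0 because \<open>p > 0\<close>.\<close>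

lemma has_real_derivative_abs_powr_mult:
  fixes p z :: real
  assumes "p > 0"
  shows "((\<lambda>z. \<bar>z\<bar> powr p * z) has_real_derivative (p + 1) * \<bar>z\<bar> powr p) (at z)"
proof -
  consider "z > 0" | "z < 0" | "z = 0" by linarith
  then show ?thesis
  proof cases
    case 1
    have "((\<lambda>z. z powr p * z) has_real_derivative (p + 1) * z powr p) (at z)"
      using 1 by (auto intro!: derivative_eq_intros simp: powr_diff algebra_simps)
    then have "((\<lambda>z. \<bar>z\<bar> powr p * z) has_real_derivative (p + 1) * z powr p) (at z)"
      by (rule has_field_derivative_transform_within_open[of _ _ _ "{0<..}"]) (use 1 in auto)
    then show ?thesis using 1 by simp
  next
    case 2
    have "((\<lambda>z. (-z) powr p * z) has_real_derivative (p + 1) * (-z) powr p) (at z)"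
      using 2 by (auto intro!: derivative_eq_intros simp: powr_diff algebra_simps divide_simps)
    then have "((\<lambda>z. \<bar>z\<bar> powr p * z) has_real_derivative (p + 1) * (-z) powr p) (at z)"
      by (rule has_field_derivative_transform_within_open[of _ _ _ "{..<0}"]) (use 2 in auto)
    then show ?thesis using 2 by simp
  next
    case 3
    have "((\<lambda>h::real. \<bar>h\<bar> powr p) \<longlongrightarrow> \<bar>0\<bar> powr p) (at 0)"
      using assms by (auto intro!: tendsto_eq_intros tendsto_powr')
    then have "((\<lambda>h::real. (\<bar>0 + h\<bar> powr p * (0 + h) - \<bar>0\<bar> powr p * 0) / h) \<longlongrightarrow> 0) (at 0)"
      by (rule tendsto_eq_rhs[OF Lim_transform_eventually])
        (auto simp: eventually_at_filter)
    then show ?thesis using 3 assms by (simp add: DERIV_def)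
  qed
qed

text \<open>The factorisation of \<open>\<bar>z\<bar> powr q\<close> into
  \<open>\<bar>z\<bar> powr (q - 2) * z\<close> and \<open>z\<close> reduces this to the product
  rule, with no separate treatment of the origin. For \<open>q = 2\<close> the convention
  \<open>0 powr 0 = 0\<close> is harmless, since the factor \<open>z\<close> vanishes there as
  well.\<close>

lemma has_real_derivative_abs_powr:
  fixes q z :: real
  assumes "q \<ge> 2"
  shows "((\<lambda>z. \<bar>z\<bar> powr q) has_real_derivative q * (\<bar>z\<bar> powr (q - 2) * z)) (at z)"
proof -
  have eq: "\<bar>z\<bar> powr q = (\<bar>z\<bar> powr (q - 2) * z) * z" for z :: real
  proof (cases "z = 0")
    case False
    have "\<bar>z\<bar> powr q = \<bar>z\<bar> powr ((q - 2) + 2)" by simp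
    also have "\<dots> = \<bar>z\<bar> powr (q - 2) * \<bar>z\<bar> powr 2" by (rule powr_add)
    finally have "\<bar>z\<bar> powr q = \<bar>z\<bar> powr (q - 2) * \<bar>z\<bar> powr 2" .
    with False show ?thesis by (simp add: powr_numeral power2_eq_square)
  qed simp
  have "((\<lambda>z. (\<bar>z\<bar> powr (q - 2) * z) * z) has_real_derivative q * (\<bar>z\<bar> powr (q - 2) * z)) (at z)"
  proof (cases "q = 2")
    case True
    have "(\<lambda>z::real. (\<bar>z\<bar> powr (q - 2) * z) * z) = (\<lambda>z. z * z)"
      using True by (auto simp: fun_eq_iff)
    then show ?thesis using True by (auto intro!: derivative_eq_intros)
  next
    case False
    show ?thesis
      by (rule DERIV_cong[OF DERIV_mult[OF has_real_derivative_abs_powr_mult[of "q - 2"] DERIV_ident]])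
        (use False assms in \<open>auto simp: algebra_simps\<close>)
  qed
  then show ?thesis by (simp add: eq[symmetric])
qed

lemma continuous_on_abs_powr_mult:
  fixes p :: real
  assumes "p \<ge> 0"
  shows "continuous_on UNIV (\<lambda>z::real. \<bar>z\<bar> powr p * z)"
proof (cases "p = 0")
  case True
  then have "(\<lambda>z::real. \<bar>z\<bar> powr p * z) = (\<lambda>z. z)" by (auto simp: fun_eq_iff)
  then show ?thesis by (simp only: continuous_on_id)
next
  case False
  with assms show ?thesis
    by (intro continuous_at_imp_continuous_on ballI DERIV_isCont[OF has_real_derivative_abs_powr_mult]) auto
qed

text \<open>Mean value inequality on the interval from \<open>-R\<close> to \<open>R\<close>. The
  summand 1 in the constant lets the same bound serve \<open>p = 0\<close>, where the function is
  the identity and \<open>R powr p\<close> is 0 for \<open>R = 0\<close>.\<close>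

lemma abs_powr_mult_lipschitz:
  fixes p R a b :: real
  assumes "p \<ge> 0" "\<bar>a\<bar> \<le> R" "\<bar>b\<bar> \<le> R"
  shows "\<bar>\<bar>a\<bar> powr p * a - \<bar>b\<bar> powr p * b\<bar> \<le> (p + 1) * (1 + R powr p) * \<bar>a - b\<bar>"
proof (cases "p = 0")
  case True
  then have "\<bar>z\<bar> powr p * z = z" for z :: real by auto
  then show ?thesis by (simp add: True mult_right_mono)
next
  case False
  have "norm (\<bar>a\<bar> powr p * a - \<bar>b\<bar> powr p * b) \<le> (p + 1) * (1 + R powr p) * norm (a - b)"
  proof (rule field_differentiable_bound[of "{-R..R}" "\<lambda>z. \<bar>z\<bar> powr p * z"
        "\<lambda>z. (p + 1) * \<bar>z\<bar> powr p"])
    show "((\<lambda>z. \<bar>z\<bar> powr p * z) has_field_derivative (p + 1) * \<bar>z\<bar> powr p) (at z within {-R..R})" for z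
      by (rule has_field_derivative_at_within[OF has_real_derivative_abs_powr_mult])
        (use False assms in simp)
    show "norm ((p + 1) * \<bar>z\<bar> powr p) \<le> (p + 1) * (1 + R powr p)" if "z \<in> {-R..R}" for z
    proof -
      have "\<bar>z\<bar> powr p \<le> R powr p" using that assms by (intro powr_mono2) auto
      then show ?thesis using assms by (auto simp: abs_mult intro!: mult_left_mono)
    qed
  qed (use assms in auto)
  then show ?thesis by simp
qed

section \<open>Global solutions of Lipschitz differential equations\<close>

lemma global_antiderivative:
  fixes g :: "real \<Rightarrow> 'a::euclidean_space"
  assumes "continuous_on UNIV g"
  shows "\<exists>G. G 0 = c \<and> (\<forall>t. (G has_vector_derivative g t) (at t))"
proof -
  have "isCont g t" for t
    using assms by (simp add: continuous_on_eq_continuous_at)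
  then have "\<exists>G. \<forall>t::real. - \<infinity> < ereal t \<longrightarrow> ereal t < \<infinity> \<longrightarrow> (G has_vector_derivative g t) (at t)"
    by (intro einterval_antiderivative) auto
  then obtain G where G: "\<And>t. (G has_vector_derivative g t) (at t)"
    by auto
  have "((\<lambda>t. G t - G 0 + c) has_vector_derivative g t - 0 + 0) (at t)" for t
    by (intro has_vector_derivative_add has_vector_derivative_diff has_vector_derivative_const G)
  then have "((\<lambda>t. G t - G 0 + c) has_vector_derivative g t) (at t)" for t
    by simp
  then show ?thesis by (intro exI[of _ "\<lambda>t. G t - G 0 + c"]) simp
qed

text \<open>One step of the factorial estimate for Picard iterates: integrating a bound of order
  \<open>n\<close> gives one of order \<open>n + 1\<close> with the extra factor
  \<open>1 / (n + 1)\<close>. Negative times follow by reflecting \<open>G\<close>.\<close>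

lemma norm_le_monomial_if_vector_derivative_le:
  fixes G :: "real \<Rightarrow> 'a::real_normed_vector"
  assumes G: "\<And>t. (G has_vector_derivative g t) (at t)"
    and g: "\<And>t. norm (g t) \<le> C * \<bar>t\<bar> ^ n" and G0: "G 0 = 0"
  shows "norm (G t) \<le> C * \<bar>t\<bar> ^ Suc n / Suc n"
proof -
  have pos: "norm (G t) \<le> C * t ^ Suc n / Suc n"
    if G: "\<And>t. (G has_vector_derivative g t) (at t)"
      and g: "\<And>t. norm (g t) \<le> C * \<bar>t\<bar> ^ n" and G0: "G 0 = 0" and "t > 0"
    for G :: "real \<Rightarrow> 'a" and g t
  proof -
    have "norm (G t - G 0) \<le> C * t ^ Suc n / Suc n - C * 0 ^ Suc n / Suc n"
    proof (rule differentiable_bound_general[where f = G and f' = g and \<phi>' = "\<lambda>s. C * s ^ n"])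
      show "continuous_on {0..t} G"
        using G by (meson continuous_at_imp_continuous_on has_vector_derivative_continuous)
      show "((\<lambda>s. C * s ^ Suc n / Suc n) has_vector_derivative C * s ^ n) (at s)" for s
        unfolding has_real_derivative_iff_has_vector_derivative[symmetric]
        by (rule derivative_eq_intros refl | simp)+
      show "norm (g s) \<le> C * s ^ n" if "0 < s" for s using g[of s] that by simp
    qed (use \<open>t > 0\<close> G in \<open>auto intro!: continuous_intros\<close>)
    then show ?thesis by (simp add: G0)
  qed
  consider "t > 0" | "t < 0" | "t = 0" by linarith
  then show ?thesis
  proof cases
    case 1
    then show ?thesis using pos[OF G g G0, of t] by simp
  next
    case 2
    have "((\<lambda>t. G (- t)) has_vector_derivative - g (- s)) (at s)" for s
      using vector_diff_chain_at[OF has_vector_derivative_minus[OF has_vector_derivative_id] G]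
      by (simp add: o_def)
    from pos[OF this, of "- t"] g[of "- _"] G0 2 show ?thesis by simp
  next
    case 3
    then show ?thesis using G0 by simp
  qed
qed

text \<open>Picard iteration on the whole line. The factorials in the bounds for successive
  differences beat every power of the time, so the iterates converge uniformly on each bounded
  interval, without a restriction to short times. The Lipschitz condition transfers this convergence
  to the derivatives.\<close>

theorem global_solution_if_lipschitz:
  fixes F :: "'a::euclidean_space \<Rightarrow> 'a"
  assumes L: "\<And>a b. norm (F a - F b) \<le> L * norm (a - b)"
  shows "\<exists>Z. Z 0 = z0 \<and> (\<forall>t. (Z has_vector_derivative F (Z t)) (at t))"
proof -
  have "L \<ge> 0"
  proof -
    obtain b :: 'a where "b \<in> Basis" using nonempty_Basis by blast
    then have "norm (b - 0) = 1" by simp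
    with L[of b 0] show ?thesis by (metis mult.right_neutral norm_ge_zero order_trans)
  qed
  have contF: "continuous_on UNIV F"
  proof (rule continuous_on_eq_continuous_at[THEN iffD2, rule_format])
    show "isCont F a" for a
    proof -
      have "((\<lambda>b. F b - F a) \<longlongrightarrow> 0) (at a)"
      proof (rule Lim_null_comparison)
        show "\<forall>\<^sub>F b in at a. norm (F b - F a) \<le> L * norm (b - a)" using L by simp
        show "((\<lambda>b. L * norm (b - a)) \<longlongrightarrow> 0) (at a)"
          by (auto intro!: tendsto_eq_intros)
      qed
      then show ?thesis by (simp add: isCont_def LIM_zero_iff)
    qed
  qed simp
  \<comment> \<open>The Picard operator: \<open>step g\<close> is the antiderivative of
    \<open>F\<close> along \<open>g\<close> with value \<open>z0\<close> at time 0.\<close>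
  define step where "step g = (SOME G. G 0 = z0 \<and> (\<forall>t. (G has_vector_derivative F (g t)) (at t)))"
    for g :: "real \<Rightarrow> 'a"
  have step: "step g 0 = z0" "(step g has_vector_derivative F (g t)) (at t)"
    if "continuous_on UNIV g" for g t
  proof -
    have "continuous_on UNIV (\<lambda>t. F (g t))"
      using continuous_on_compose2[OF contF that] by simp
    from someI_ex[OF global_antiderivative[OF this, of z0]]
    show "step g 0 = z0" "(step g has_vector_derivative F (g t)) (at t)"
      unfolding step_def by auto
  qed
  define X where "X n = (step ^^ n) (\<lambda>_. z0)" for n
  have X0: "X 0 = (\<lambda>_. z0)" and XS: "X (Suc n) = step (X n)" for n
    by (auto simp: X_def)
  have contX: "continuous_on UNIV (X n)" for n
  proof (induction n)
    case (Suc n)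
    then show ?case unfolding XS
      by (meson step(2) continuous_at_imp_continuous_on has_vector_derivative_continuous)
  qed (simp add: X0)
  have derX: "(X (Suc n) has_vector_derivative F (X n t)) (at t)" for n t
    unfolding XS by (rule step(2)[OF contX])
  have X_at0: "X n 0 = z0" for n by (cases n) (auto simp: X0 XS step(1)[OF contX])
  define M where "M = norm (F z0)"
  have bound: "norm (X (Suc n) t - X n t) \<le> M * L ^ n / fact n * \<bar>t\<bar> ^ Suc n / Suc n" for n t
  proof (induction n arbitrary: t)
    case 0
    have "((\<lambda>t. X (Suc 0) t - X 0 t) has_vector_derivative F z0) (at t)" for t
      unfolding X0 by (rule derivative_eq_intros derX refl | simp add: X0)+
    from norm_le_monomial_if_vector_derivative_le[OF this, of M 0 t] show ?case
      by (simp add: M_def X_at0)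
  next
    case (Suc n)
    have d: "((\<lambda>t. X (Suc (Suc n)) t - X (Suc n) t) has_vector_derivative F (X (Suc n) t) - F (X n t)) (at t)" for t
      by (rule derivative_eq_intros derX refl)+
    have "norm (F (X (Suc n) t) - F (X n t)) \<le> M * L ^ Suc n / fact (Suc n) * \<bar>t\<bar> ^ Suc n" for t
    proof -
      have "norm (F (X (Suc n) t) - F (X n t)) \<le> L * (M * L ^ n / fact n * \<bar>t\<bar> ^ Suc n / Suc n)"
        by (rule order_trans[OF L mult_left_mono[OF Suc.IH \<open>L \<ge> 0\<close>]])
      also have "\<dots> = M * L ^ Suc n / fact (Suc n) * \<bar>t\<bar> ^ Suc n"
        by (simp add: field_simps)
      finally show ?thesis .
    qed
    from norm_le_monomial_if_vector_derivative_le[OF d this, of t] show ?case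
      by (simp add: X_at0)
  qed
  \<comment> \<open>The telescoping series of the iterates, so that the Weierstrass test applies to
    its terms.\<close>
  define Z where "Z t = z0 + (\<Sum>n. X (Suc n) t - X n t)" for t
  have lim: "uniform_limit (ball 0 T) X Z sequentially" for T
  proof -
    have "summable (\<lambda>n. M * T * (inverse (fact n) * (L * T) ^ n))"
      by (intro summable_mult summable_exp)
    moreover have "norm (X (Suc n) t - X n t) \<le> M * T * (inverse (fact n) * (L * T) ^ n)"
      if "t \<in> ball 0 T" for n t
    proof -
      have t: "\<bar>t\<bar> \<le> T" using that by simp
      have "norm (X (Suc n) t - X n t) \<le> M * L ^ n / fact n * \<bar>t\<bar> ^ Suc n / Suc n" by (rule bound)
      \<comment> \<open>Dropping the factor \<open>1 / Suc n\<close> leaves the terms of an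
        exponential series as majorant.\<close>
      also have "\<dots> \<le> M * L ^ n / fact n * \<bar>t\<bar> ^ Suc n / 1"
        using \<open>L \<ge> 0\<close> by (intro divide_left_mono) (auto simp: M_def)
      also have "\<dots> \<le> M * L ^ n / fact n * T ^ Suc n"
        using \<open>L \<ge> 0\<close> t by (auto simp: M_def intro!: mult_left_mono power_mono mult_mono divide_right_mono)
      finally show ?thesis by (simp add: field_simps power_mult_distrib)
    qed
    ultimately have "uniform_limit (ball 0 T) (\<lambda>n t. \<Sum>i<n. X (Suc i) t - X i t)
        (\<lambda>t. \<Sum>i. X (Suc i) t - X i t) sequentially"
      by (intro Weierstrass_m_test)
    then have "uniform_limit (ball 0 T) (\<lambda>n t. z0 + (\<Sum>i<n. X (Suc i) t - X i t)) Z sequentially"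
      unfolding Z_def by (intro uniform_limit_intros)
    moreover have "(\<lambda>n t. z0 + (\<Sum>i<n. X (Suc i) t - X i t)) = X"
    proof (intro ext)
      show "z0 + (\<Sum>i<n. X (Suc i) t - X i t) = X n t" for n t
        using sum_lessThan_telescope[of "\<lambda>n. X n t" n] by (simp add: X0)
    qed
    ultimately show ?thesis by simp
  qed
  have derZ: "(Z has_vector_derivative F (Z t)) (at t)" for t
  proof -
    define S where "S = ball (0::real) (\<bar>t\<bar> + 1)"
    have limX: "(\<lambda>n. X (Suc n) s) \<longlonglongrightarrow> Z s" if "s \<in> S" for s
      using tendsto_uniform_limitI[OF lim that[unfolded S_def]] LIMSEQ_Suc by blast
    \<comment> \<open>Differentiation of a limit of functions with uniformly convergent derivatives.
      The sequence is shifted by one because the derivative of \<open>X (Suc n)\<close> is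
      \<open>F (X n s)\<close>; its limit \<open>g\<close> then agrees with \<open>Z\<close> on
      \<open>S\<close>.\<close>
    have "\<exists>g. \<forall>s\<in>S. (\<lambda>n. X (Suc n) s) \<longlonglongrightarrow> g s \<and>
        (g has_derivative (\<lambda>h. h *\<^sub>R F (Z s))) (at s within S)"
    proof (rule has_derivative_sequence)
      show "convex S" "0 \<in> S" by (auto simp: S_def)
      show "(X (Suc n) has_derivative (\<lambda>h. h *\<^sub>R F (X n s))) (at s within S)" for n s
        using derX[of n s] by (auto simp: has_vector_derivative_def intro: has_derivative_at_withinI)
      show "(\<lambda>n. X (Suc n) 0) \<longlonglongrightarrow> z0" by (simp add: X_at0)
      fix e :: real assume "e > 0"
      \<comment> \<open>The denominator \<open>L + 1\<close> instead of \<open>L\<close> covers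
        \<open>L = 0\<close>.\<close>
      then have e: "e / (L + 1) > 0" using \<open>L \<ge> 0\<close> by simp
      show "\<forall>\<^sub>F n in sequentially. \<forall>s\<in>S. \<forall>h::real. norm (h *\<^sub>R F (X n s) - h *\<^sub>R F (Z s)) \<le> e * norm h"
      proof (rule eventually_mono[OF uniform_limitD[OF lim[of "\<bar>t\<bar> + 1"] e]], intro ballI allI)
        fix n s and h :: real assume "\<forall>s\<in>ball 0 (\<bar>t\<bar> + 1). dist (X n s) (Z s) < e / (L + 1)" and "s \<in> S"
        then have "norm (X n s - Z s) \<le> e / (L + 1)" by (auto simp: S_def dist_norm less_imp_le)
        then have "L * norm (X n s - Z s) \<le> L * (e / (L + 1))" using \<open>L \<ge> 0\<close> by (rule mult_left_mono)
        also have "\<dots> \<le> e" using \<open>L \<ge> 0\<close> \<open>e > 0\<close> by (simp add: field_simps)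
        finally have "norm (F (X n s) - F (Z s)) \<le> e" using L[of "X n s" "Z s"] by simp
        then have "norm h * norm (F (X n s) - F (Z s)) \<le> norm h * e" by (intro mult_left_mono) auto
        then show "norm (h *\<^sub>R F (X n s) - h *\<^sub>R F (Z s)) \<le> e * norm h"
          by (simp add: scaleR_diff_right[symmetric] mult.commute)
      qed
    qed
    then obtain g where g: "\<And>s. s \<in> S \<Longrightarrow> (\<lambda>n. X (Suc n) s) \<longlonglongrightarrow> g s"
      "\<And>s. s \<in> S \<Longrightarrow> (g has_derivative (\<lambda>h. h *\<^sub>R F (Z s))) (at s within S)" by blast
    have t: "t \<in> S" "open S" by (auto simp: S_def)
    have "(Z has_derivative (\<lambda>h. h *\<^sub>R F (Z t))) (at t)"
    proof (rule has_derivative_transform_within_open[OF _ t(2,1)])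
      show "(g has_derivative (\<lambda>h. h *\<^sub>R F (Z t))) (at t)"
        using g(2)[OF t(1)] unfolding at_within_open[OF t] .
      show "g s = Z s" if "s \<in> S" for s
        using LIMSEQ_unique[OF g(1) limX] that by blast
    qed
    then show ?thesis by (simp add: has_vector_derivative_def)
  qed
  moreover have "Z 0 = z0" by (simp add: Z_def X_at0)
  ultimately show ?thesis by blast
qed

section \<open>The equation for the horizontal coordinate\<close>

text \<open>The part of the Hamiltonian system for \<open>x\<close> and \<open>u\<close>, with the
  constant \<open>v\<close> as a parameter; \<open>y\<close> does not feed back into it. For
  \<alpha> = 1 it is the harmonic oscillator. The power and the last factor \<open>x t\<close> are
  bracketed together because their product is continuous and locally Lipschitz for every \<alpha>
  \<ge> 1.\<close>

definition oscillator :: "real \<Rightarrow> real \<Rightarrow> (real \<Rightarrow> real) \<Rightarrow> (real \<Rightarrow> real) \<Rightarrow> bool" where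
  "oscillator \<alpha> v x u \<longleftrightarrow>
     (\<forall>t. (x has_real_derivative u t) (at t)) \<and>
     (\<forall>t. (u has_real_derivative - (\<alpha> * v\<^sup>2 * (\<bar>x t\<bar> powr (2 * (\<alpha> - 1)) * x t))) (at t))"

lemma oscillatorD:
  assumes "oscillator \<alpha> v x u"
  shows "(x has_real_derivative u t) (at t)"
    and "(u has_real_derivative - (\<alpha> * v\<^sup>2 * (\<bar>x t\<bar> powr (2 * (\<alpha> - 1)) * x t))) (at t)"
    and "isCont x t" and "isCont u t"
  using assms unfolding oscillator_def by (auto intro: DERIV_isCont)

section \<open>Conserved energy and symmetries of the equation\<close>

lemma oscillator_abs_powr_derivative:
  assumes "\<alpha> \<ge> 1" "oscillator \<alpha> v x u"
  shows "((\<lambda>t. \<bar>x t\<bar> powr (2 * \<alpha>)) has_real_derivative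
           2 * \<alpha> * (\<bar>x t\<bar> powr (2 * (\<alpha> - 1)) * x t) * u t) (at t)"
proof -
  have "2 * \<alpha> - 2 = 2 * (\<alpha> - 1)" by simp
  have "((\<lambda>t. \<bar>x t\<bar> powr (2 * \<alpha>)) has_real_derivative
      2 * \<alpha> * (\<bar>x t\<bar> powr (2 * \<alpha> - 2) * x t) * u t) (at t)"
    using assms(1)
    by (intro DERIV_chain2[OF has_real_derivative_abs_powr oscillatorD(1)[OF assms(2)]]) simp
  then show ?thesis unfolding \<open>2 * \<alpha> - 2 = 2 * (\<alpha> - 1)\<close> .
qed

lemma abs_powr_twice_split:
  fixes z :: real
  shows "\<bar>z\<bar> powr (2 * (\<alpha> - 1)) * z * z = \<bar>z\<bar> powr (2 * \<alpha>)"
proof (cases "z = 0")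
  case False
  have "\<bar>z\<bar> powr (2 * \<alpha>) = \<bar>z\<bar> powr (2 * (\<alpha> - 1) + 2)" by (simp add: algebra_simps)
  also have "\<dots> = \<bar>z\<bar> powr (2 * (\<alpha> - 1)) * \<bar>z\<bar> powr 2" by (rule powr_add)
  finally show ?thesis using False by (simp add: power2_eq_square)
qed simp

text \<open>The conserved quantity is twice the Hamiltonian; in its derivative the two terms cancel
  by the equation for \<open>u\<close>.\<close>

lemma oscillator_energy:
  assumes "\<alpha> \<ge> 1" "oscillator \<alpha> v x u"
  shows "(u t)\<^sup>2 + v\<^sup>2 * \<bar>x t\<bar> powr (2 * \<alpha>) = (u 0)\<^sup>2 + v\<^sup>2 * \<bar>x 0\<bar> powr (2 * \<alpha>)"
proof -
  have "((\<lambda>t. (u t)\<^sup>2 + v\<^sup>2 * \<bar>x t\<bar> powr (2 * \<alpha>)) has_real_derivative 0) (at t)" for t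
    by (rule derivative_eq_intros oscillator_abs_powr_derivative[OF assms] oscillatorD(2)[OF assms(2)]
          refl | simp add: algebra_simps)+
  then show ?thesis using DERIV_isconst_all by blast
qed

lemma oscillator_reflect:
  assumes "oscillator \<alpha> v x u"
  shows "oscillator \<alpha> v (\<lambda>t. x (- t)) (\<lambda>t. - u (- t))"
  unfolding oscillator_def
proof (intro conjI allI)
  fix t
  show "((\<lambda>t. x (- t)) has_real_derivative - u (- t)) (at t)"
    using DERIV_chain2[OF oscillatorD(1)[OF assms, of "- t"] DERIV_minus[OF DERIV_ident]] by simp
  show "((\<lambda>t. - u (- t)) has_real_derivative
      - (\<alpha> * v\<^sup>2 * (\<bar>x (- t)\<bar> powr (2 * (\<alpha> - 1)) * x (- t)))) (at t)"
    using DERIV_minus[OF DERIV_chain2[OF oscillatorD(2)[OF assms, of "- t"] DERIV_minus[OF DERIV_ident]]]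
    by simp
qed

text \<open>The acceleration is multiplied by \<open>a * w\<^sup>2\<close> and the force term,
  homogeneous of degree 2\<alpha> - 1, by \<open>a powr (2 * \<alpha> - 1)\<close>. The factor
  \<open>w * a powr (1 - \<alpha>)\<close> on \<open>v\<close> balances the two.\<close>

lemma oscillator_scale_shift:
  assumes "oscillator \<alpha> v x u" "a > 0"
  shows "oscillator \<alpha> (v * w * a powr (1 - \<alpha>)) (\<lambda>t. a * x (s + w * t)) (\<lambda>t. a * w * u (s + w * t))"
  unfolding oscillator_def
proof (intro conjI allI)
  fix t
  have s: "((\<lambda>t. s + w * t) has_real_derivative w) (at t)"
    by (auto intro!: derivative_eq_intros)
  show "((\<lambda>t. a * x (s + w * t)) has_real_derivative a * w * u (s + w * t)) (at t)"
    by (rule DERIV_cong[OF DERIV_cmult[OF DERIV_chain2[OF oscillatorD(1)[OF assms(1)] s]]]) simp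
  have "(a powr (1 - \<alpha>))\<^sup>2 * a powr (2 * (\<alpha> - 1)) = 1"
    using assms(2) by (simp add: powr_power flip: powr_add)
  then have "(v * w * a powr (1 - \<alpha>))\<^sup>2 * (\<bar>a * x r\<bar> powr (2 * (\<alpha> - 1)) * (a * x r)) =
      v\<^sup>2 * w\<^sup>2 * a * (\<bar>x r\<bar> powr (2 * (\<alpha> - 1)) * x r)" for r
    using assms(2) by (simp add: abs_mult powr_mult power_mult_distrib algebra_simps)
  then have eq: "\<alpha> * (v * w * a powr (1 - \<alpha>))\<^sup>2 * (\<bar>a * x r\<bar> powr (2 * (\<alpha> - 1)) * (a * x r)) =
      \<alpha> * (v\<^sup>2 * w\<^sup>2 * a * (\<bar>x r\<bar> powr (2 * (\<alpha> - 1)) * x r))" for r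
    by (simp only: mult.assoc)
  show "((\<lambda>t. a * w * u (s + w * t)) has_real_derivative
      - (\<alpha> * (v * w * a powr (1 - \<alpha>))\<^sup>2 *
         (\<bar>a * x (s + w * t)\<bar> powr (2 * (\<alpha> - 1)) * (a * x (s + w * t))))) (at t)"
    unfolding eq
    by (rule DERIV_cong[OF DERIV_cmult[OF DERIV_chain2[OF oscillatorD(2)[OF assms(1)] s]]])
      (simp add: power2_eq_square)
qed

section \<open>Uniqueness by a Gronwall estimate, and global existence\<close>

lemma oscillator_unique_nonneg:
  assumes \<alpha>: "\<alpha> \<ge> 1" and o: "oscillator \<alpha> v x u" "oscillator \<alpha> v x' u'"
    and init: "x 0 = x' 0" "u 0 = u' 0" and "T \<ge> 0"
  shows "x T = x' T \<and> u T = u' T"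
proof -
  have "continuous_on {0..T} x" "continuous_on {0..T} x'"
    using oscillatorD(3)[OF o(1)] oscillatorD(3)[OF o(2)]
    by (auto intro!: continuous_at_imp_continuous_on)
  then have "bounded (x ` {0..T})" "bounded (x' ` {0..T})"
    by (auto intro!: compact_imp_bounded compact_continuous_image)
  then obtain R1 R2 where "\<And>t. t \<in> {0..T} \<Longrightarrow> \<bar>x t\<bar> \<le> R1" "\<And>t. t \<in> {0..T} \<Longrightarrow> \<bar>x' t\<bar> \<le> R2"
    unfolding bounded_iff by (metis imageI real_norm_def)
  then have R: "\<bar>x t\<bar> \<le> max R1 R2" "\<bar>x' t\<bar> \<le> max R1 R2" if "0 \<le> t" "t \<le> T" for t
    using that by (auto simp: le_max_iff_disj)
  let ?f = "\<lambda>z::real. \<bar>z\<bar> powr (2 * (\<alpha> - 1)) * z"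
  \<comment> \<open>On the compact interval both solutions stay bounded, so the force is Lipschitz
    along them; \<open>K\<close> is the resulting constant.\<close>
  define K where "K = \<alpha> * v\<^sup>2 * ((2 * (\<alpha> - 1) + 1) * (1 + max R1 R2 powr (2 * (\<alpha> - 1))))"
  \<comment> \<open>The squared distance in the phase plane. It satisfies
    \<open>E' t \<le> (1 + K) * E t\<close> and vanishes at 0, so with an integrating factor it
    stays 0.\<close>
  define E where "E t = (x t - x' t)\<^sup>2 + (u t - u' t)\<^sup>2" for t
  define E' where "E' t = 2 * (x t - x' t) * (u t - u' t)
      - 2 * (u t - u' t) * (\<alpha> * v\<^sup>2 * (?f (x t) - ?f (x' t)))" for t
  have E': "(E has_real_derivative E' t) (at t)" for t
    unfolding E_def E'_def
    by (rule derivative_eq_intros oscillatorD(1,2)[OF o(1)] oscillatorD(1,2)[OF o(2)] refl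
        | simp add: algebra_simps)+
  have le: "E' t \<le> (1 + K) * E t" if t: "0 \<le> t" "t \<le> T" for t
  proof -
    define d e g where "d = x t - x' t" and "e = u t - u' t"
      and "g = \<alpha> * v\<^sup>2 * (?f (x t) - ?f (x' t))"
    have "K \<ge> 0" using \<alpha> by (simp add: K_def)
    have "\<bar>?f (x t) - ?f (x' t)\<bar> \<le>
        (2 * (\<alpha> - 1) + 1) * (1 + max R1 R2 powr (2 * (\<alpha> - 1))) * \<bar>d\<bar>"
      unfolding d_def by (rule abs_powr_mult_lipschitz) (use \<alpha> R t in auto)
    then have "\<alpha> * v\<^sup>2 * \<bar>?f (x t) - ?f (x' t)\<bar> \<le>
        \<alpha> * v\<^sup>2 * ((2 * (\<alpha> - 1) + 1) * (1 + max R1 R2 powr (2 * (\<alpha> - 1))) * \<bar>d\<bar>)"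
      using \<alpha> by (intro mult_left_mono) auto
    then have g: "\<bar>g\<bar> \<le> K * \<bar>d\<bar>"
      using \<alpha> by (simp add: g_def K_def abs_mult mult.assoc)
    have "2 * d * e \<le> d\<^sup>2 + e\<^sup>2" by (rule sum_squares_bound)
    moreover have "- (2 * e * g) \<le> K * (d\<^sup>2 + e\<^sup>2)"
    proof -
      have "- (2 * e * g) \<le> 2 * \<bar>e\<bar> * \<bar>g\<bar>"
        by (metis abs_ge_minus_self abs_mult abs_numeral)
      also have "\<dots> \<le> 2 * \<bar>e\<bar> * (K * \<bar>d\<bar>)" using g by (intro mult_left_mono) auto
      also have "\<dots> = K * (2 * \<bar>d\<bar> * \<bar>e\<bar>)" by simp
      also have "\<dots> \<le> K * (\<bar>d\<bar>\<^sup>2 + \<bar>e\<bar>\<^sup>2)"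
        using \<open>K \<ge> 0\<close> by (intro mult_left_mono sum_squares_bound)
      finally show ?thesis by simp
    qed
    ultimately show ?thesis
      unfolding E_def E'_def d_def[symmetric] e_def[symmetric] g_def[symmetric]
      by (simp add: algebra_simps)
  qed
  have "E T * exp (- ((1 + K) * T)) \<le> E 0 * exp (- ((1 + K) * 0))"
  proof (rule DERIV_nonpos_imp_nonincreasing[OF \<open>T \<ge> 0\<close>])
    fix t assume t: "0 \<le> t" "t \<le> T"
    have "((\<lambda>t. E t * exp (- ((1 + K) * t))) has_real_derivative
        (E' t - (1 + K) * E t) * exp (- ((1 + K) * t))) (at t)"
      by (rule derivative_eq_intros E' refl | simp add: algebra_simps)+
    moreover have "(E' t - (1 + K) * E t) * exp (- ((1 + K) * t)) \<le> 0"
      using le[OF t] by (simp add: mult_nonpos_nonneg)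
    ultimately show "\<exists>y. ((\<lambda>t. E t * exp (- ((1 + K) * t))) has_real_derivative y) (at t) \<and> y \<le> 0"
      by blast
  qed
  then have "E T \<le> 0" using init by (simp add: E_def mult_le_0_iff)
  then show ?thesis
    unfolding E_def using sum_power2_le_zero_iff[of "x T - x' T" "u T - u' T"] by simp
qed

lemma oscillator_unique:
  assumes "\<alpha> \<ge> 1" and "oscillator \<alpha> v x u" "oscillator \<alpha> v x' u'"
    and "x 0 = x' 0" "u 0 = u' 0"
  shows "x t = x' t \<and> u t = u' t"
proof (cases "t \<ge> 0")
  case False
  then show ?thesis
    using oscillator_unique_nonneg[OF assms(1) oscillator_reflect[OF assms(2)] oscillator_reflect[OF assms(3)],
        of "- t"] assms(4,5) by simp
qed (use oscillator_unique_nonneg assms in blast)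

text \<open>The force is only locally Lipschitz. For \<open>v \<noteq> 0\<close> it is therefore
  frozen outside a large interval, which makes the system globally Lipschitz, and conservation of
  the energy of the modified system shows that the solution never leaves the interval. It thus
  solves the original system.\<close>

lemma oscillator_exists:
  assumes \<alpha>: "\<alpha> \<ge> 1"
  shows "\<exists>x u. x 0 = x\<^sub>0 \<and> u 0 = u\<^sub>0 \<and> oscillator \<alpha> v x u"
proof (cases "v = 0")
  case True
  then show ?thesis
    by (intro exI[of _ "\<lambda>t. x\<^sub>0 + u\<^sub>0 * t"] exI[of _ "\<lambda>_. u\<^sub>0"])
      (auto simp: oscillator_def intro!: derivative_eq_intros)
next
  case False
  \<comment> \<open>Chosen with \<open>R \<ge> 1\<close>, so that
    \<open>R powr (2 * \<alpha>) \<ge> R\<close>, and large enough that the initial energy lies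
    strictly below the potential at distance \<open>R\<close>.\<close>
  define R where "R = 1 + \<bar>x\<^sub>0\<bar> + \<bar>x\<^sub>0\<bar> powr (2 * \<alpha>) + u\<^sub>0\<^sup>2 / v\<^sup>2"
  have R1: "R \<ge> 1" by (simp add: R_def)
  have Rx: "\<bar>x\<^sub>0\<bar> \<le> R" by (simp add: R_def)
  have "R powr 1 \<le> R powr (2 * \<alpha>)" using R1 \<alpha> by (intro powr_mono) auto
  then have "u\<^sub>0\<^sup>2 / v\<^sup>2 + \<bar>x\<^sub>0\<bar> powr (2 * \<alpha>) < R powr (2 * \<alpha>)"
    using R1 by (simp add: R_def)
  then have "v\<^sup>2 * (u\<^sub>0\<^sup>2 / v\<^sup>2 + \<bar>x\<^sub>0\<bar> powr (2 * \<alpha>)) < v\<^sup>2 * R powr (2 * \<alpha>)"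
    using False by simp
  then have Re: "u\<^sub>0\<^sup>2 + v\<^sup>2 * \<bar>x\<^sub>0\<bar> powr (2 * \<alpha>) < v\<^sup>2 * R powr (2 * \<alpha>)"
    using False by (simp add: distrib_left)
  let ?f = "\<lambda>z::real. \<bar>z\<bar> powr (2 * (\<alpha> - 1)) * z"
  \<comment> \<open>Clamping to the interval from \<open>-R\<close> to \<open>R\<close>; it is
    nonexpansive, so the Lipschitz constant of the force on the interval becomes a global
    one.\<close>
  define c where "c z = max (- R) (min R z)" for z
  have c: "\<bar>c z\<bar> \<le> R" "\<bar>c z - c z'\<bar> \<le> \<bar>z - z'\<bar>" for z z' using R1 by (auto simp: c_def)
  define K where "K = (2 * (\<alpha> - 1) + 1) * (1 + R powr (2 * (\<alpha> - 1)))"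
  have K: "K \<ge> 0" using \<alpha> by (simp add: K_def)
  have lip: "\<bar>?f (c z) - ?f (c z')\<bar> \<le> K * \<bar>z - z'\<bar>" for z z'
  proof -
    have "\<bar>?f (c z) - ?f (c z')\<bar> \<le> K * \<bar>c z - c z'\<bar>"
      unfolding K_def by (rule abs_powr_mult_lipschitz) (use \<alpha> c in auto)
    also have "\<dots> \<le> K * \<bar>z - z'\<bar>" using c K by (intro mult_left_mono) auto
    finally show ?thesis .
  qed
  define F where "F p = (snd p, - (\<alpha> * v\<^sup>2 * ?f (c (fst p))))" for p :: "real \<times> real"
  have "norm (F p - F p') \<le> (1 + \<alpha> * v\<^sup>2 * K) * norm (p - p')" for p p'
  proof -
    have "norm (F p - F p') \<le> \<bar>snd (p - p')\<bar> + \<bar>\<alpha> * v\<^sup>2 * (?f (c (fst p')) - ?f (c (fst p)))\<bar>"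
      using norm_Pair_le[of "snd p - snd p'" "\<alpha> * v\<^sup>2 * (?f (c (fst p')) - ?f (c (fst p)))"]
      by (simp add: F_def algebra_simps)
    also have "\<dots> = \<bar>snd (p - p')\<bar> + \<alpha> * v\<^sup>2 * \<bar>?f (c (fst p')) - ?f (c (fst p))\<bar>"
      using \<alpha> by (simp add: abs_mult)
    also have "\<dots> \<le> norm (p - p') + \<alpha> * v\<^sup>2 * (K * norm (p - p'))"
    proof (intro add_mono mult_left_mono order_trans[OF lip])
      show "\<bar>snd (p - p')\<bar> \<le> norm (p - p')" using norm_snd_le[of "snd (p - p')" "fst (p - p')"] by (metis prod.collapse real_norm_def)
      show "\<bar>fst p' - fst p\<bar> \<le> norm (p - p')"
        using norm_fst_le[of "fst (p - p')" "snd (p - p')"]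
        by (metis abs_minus_commute fst_diff prod.collapse real_norm_def)
    qed (use \<alpha> K in auto)
    finally show ?thesis by (simp add: algebra_simps)
  qed
  from global_solution_if_lipschitz[OF this, of "(x\<^sub>0, u\<^sub>0)"]
  obtain Z where Z0: "Z 0 = (x\<^sub>0, u\<^sub>0)" and Z: "\<And>t. (Z has_vector_derivative F (Z t)) (at t)" by blast
  define x u where "x t = fst (Z t)" and "u t = snd (Z t)" for t
  have dx: "(x has_real_derivative u t) (at t)" for t
    using bounded_linear.has_vector_derivative[OF bounded_linear_fst Z[of t]]
    by (simp add: x_def[abs_def] u_def F_def has_real_derivative_iff_has_vector_derivative)
  have du: "(u has_real_derivative - (\<alpha> * v\<^sup>2 * ?f (c (x t)))) (at t)" for t
    using bounded_linear.has_vector_derivative[OF bounded_linear_snd Z[of t]]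
    by (simp add: x_def u_def[abs_def] F_def has_real_derivative_iff_has_vector_derivative)
  have "continuous_on UNIV (\<lambda>z. ?f (c z))"
    unfolding c_def using \<alpha>
    by (intro continuous_on_compose2[OF continuous_on_abs_powr_mult] continuous_intros) auto
  \<comment> \<open>\<open>V\<close> is the potential of the truncated force:
    \<open>2 * \<alpha> * V z\<close> is \<open>\<bar>z\<bar> powr (2 * \<alpha>)\<close> inside the
    interval and at least \<open>R powr (2 * \<alpha>)\<close> outside, which gives the energy
    barrier.\<close>
  from global_antiderivative[OF this, of 0]
  obtain V where V0: "V 0 = 0" and dV: "\<And>z. (V has_real_derivative ?f (c z)) (at z)"
    by (auto simp: has_real_derivative_iff_has_vector_derivative)
  have V_in: "2 * \<alpha> * V z = \<bar>z\<bar> powr (2 * \<alpha>)" if "z \<in> {- R..R}" for z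
  proof -
    have "\<exists>k. \<forall>z\<in>{- R..R}. 2 * \<alpha> * V z - \<bar>z\<bar> powr (2 * \<alpha>) = k"
    proof (rule has_field_derivative_zero_constant)
      fix z assume z: "z \<in> {- R..R}"
      then have "c z = z" by (simp add: c_def)
      moreover have "2 * \<alpha> - 2 = 2 * (\<alpha> - 1)" by simp
      ultimately have "((\<lambda>z. 2 * \<alpha> * V z - \<bar>z\<bar> powr (2 * \<alpha>)) has_real_derivative 0) (at z)"
        using DERIV_diff[OF DERIV_cmult[OF dV, of "2 * \<alpha>" z] has_real_derivative_abs_powr[of "2 * \<alpha>" z]] \<alpha>
        by simp
      then show "((\<lambda>z. 2 * \<alpha> * V z - \<bar>z\<bar> powr (2 * \<alpha>)) has_real_derivative 0) (at z within {- R..R})"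
        by (rule has_field_derivative_at_within)
    qed simp
    then obtain k where k: "\<And>z. z \<in> {- R..R} \<Longrightarrow> 2 * \<alpha> * V z - \<bar>z\<bar> powr (2 * \<alpha>) = k" by blast
    from k[of 0] k[OF that] R1 V0 show ?thesis by simp
  qed
  have V_out: "2 * \<alpha> * V z \<ge> R powr (2 * \<alpha>)" if "\<bar>z\<bar> \<ge> R" for z
  proof (cases "z \<ge> 0")
    case True
    then have "V R \<le> V z"
      using that R1
      by (intro DERIV_nonneg_imp_nondecreasing[of R z V]) (auto intro!: exI dV simp: c_def)
    then show ?thesis using V_in[of R] R1 \<alpha> by (smt (verit) atLeastAtMost_iff mult_left_mono)
  next
    case False
    then have "V (- R) \<le> V z"
      using that R1
      by (intro DERIV_nonpos_imp_nonincreasing[of z "- R" V])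
        (auto intro!: exI dV simp: c_def mult_nonneg_nonpos)
    then show ?thesis using V_in[of "- R"] R1 \<alpha> by (smt (verit) atLeastAtMost_iff mult_left_mono)
  qed
  have "((\<lambda>t. (u t)\<^sup>2 + v\<^sup>2 * (2 * \<alpha> * V (x t))) has_real_derivative 0) (at t)" for t
    by (rule derivative_eq_intros DERIV_chain2[OF dV dx] du refl | simp add: algebra_simps)+
  then have en: "(u t)\<^sup>2 + v\<^sup>2 * (2 * \<alpha> * V (x t)) = (u 0)\<^sup>2 + v\<^sup>2 * (2 * \<alpha> * V (x 0))" for t
    using DERIV_isconst_all by blast
  have "\<bar>x t\<bar> < R" for t
  proof (rule ccontr)
    assume "\<not> \<bar>x t\<bar> < R"
    then have "v\<^sup>2 * R powr (2 * \<alpha>) \<le> v\<^sup>2 * (2 * \<alpha> * V (x t))" using V_out by (intro mult_left_mono) auto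
    also have "\<dots> \<le> (u 0)\<^sup>2 + v\<^sup>2 * (2 * \<alpha> * V (x 0))" using en[of t] zero_le_power2[of "u t"] by linarith
    also have "\<dots> = u\<^sub>0\<^sup>2 + v\<^sup>2 * \<bar>x\<^sub>0\<bar> powr (2 * \<alpha>)" using V_in[of x\<^sub>0] Rx
      by (simp add: x_def u_def Z0 abs_le_iff minus_le_iff)
    finally show False using Re by simp
  qed
  then have cx: "c (x t) = x t" for t by (smt (verit) c_def max_def min_def)
  have "oscillator \<alpha> v x u"
    using dx du unfolding cx oscillator_def by blast
  then show ?thesis by (intro exI[of _ x] exI[of _ u]) (simp add: x_def u_def Z0)
qed

section \<open>Explicit form of the exponential map\<close>

text \<open>The definite description is settled here: \<open>v\<close> is constant, \<open>x\<close>
  and \<open>u\<close> are determined by uniqueness for the oscillator, and \<open>y\<close> is then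
  a quadrature with given initial value.\<close>

lemma grushin_exp_eq:
  assumes \<alpha>: "\<alpha> \<ge> 1" and o: "oscillator \<alpha> v x u"
    and y: "\<And>t. (y has_real_derivative v * \<bar>x t\<bar> powr (2 * \<alpha>)) (at t)"
  shows "grushin_exp \<alpha> (x 0, y 0) (u 0, v) = (x 1, y 1)"
  unfolding grushin_exp_def
proof (rule the_equality)
  have "grushin_normal_extremal \<alpha> (x 0, y 0) (u 0, v) u (\<lambda>_. v) x y"
    using o y by (auto simp: grushin_normal_extremal_def oscillator_def mult.assoc)
  then show "\<exists>u' v' x' y'. grushin_normal_extremal \<alpha> (x 0, y 0) (u 0, v) u' v' x' y' \<and> (x 1, y 1) = (x' 1, y' 1)"
    by blast
next
  fix p
  assume "\<exists>u' v' x' y'. grushin_normal_extremal \<alpha> (x 0, y 0) (u 0, v) u' v' x' y' \<and> p = (x' 1, y' 1)"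
  then obtain u' v' x' y' where e: "grushin_normal_extremal \<alpha> (x 0, y 0) (u 0, v) u' v' x' y'"
    and p: "p = (x' 1, y' 1)" by blast
  have "v' t = v' 0" for t
    using e DERIV_isconst_all[of v' t 0] by (auto simp: grushin_normal_extremal_def)
  then have v': "v' = (\<lambda>_. v)" using e by (auto simp: grushin_normal_extremal_def)
  have "oscillator \<alpha> v x' u'"
    using e unfolding v' by (auto simp: grushin_normal_extremal_def oscillator_def mult.assoc)
  from oscillator_unique[OF \<alpha> this o] e have x': "x' = x"
    by (auto simp: grushin_normal_extremal_def)
  have "((\<lambda>t. y' t - y t) has_real_derivative 0) (at t)" for t
    using DERIV_diff[OF _ y, of y' "v * \<bar>x t\<bar> powr (2 * \<alpha>)" t] e
    by (simp add: grushin_normal_extremal_def v' x')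
  from DERIV_isconst_all[of "\<lambda>t. y' t - y t" 1 0] this have "y' 1 = y 1"
    using e by (simp add: grushin_normal_extremal_def)
  then show "p = (x 1, y 1)" using p x' by simp
qed

lemma grushin_exp_exists:
  assumes \<alpha>: "\<alpha> \<ge> 1"
  obtains x u y where "x 0 = x\<^sub>0" "u 0 = u\<^sub>0" "y 0 = y\<^sub>0" "oscillator \<alpha> v x u"
    "\<And>t. (y has_real_derivative v * \<bar>x t\<bar> powr (2 * \<alpha>)) (at t)"
    "grushin_exp \<alpha> (x\<^sub>0, y\<^sub>0) (u\<^sub>0, v) = (x 1, y 1)"
proof -
  obtain x u where xu: "x 0 = x\<^sub>0" "u 0 = u\<^sub>0" "oscillator \<alpha> v x u"
    using oscillator_exists[OF \<alpha>] by blast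
  have "continuous_on UNIV (\<lambda>t. v * \<bar>x t\<bar> powr (2 * \<alpha>))"
    by (intro continuous_at_imp_continuous_on ballI isCont_mult continuous_const
        DERIV_isCont[OF oscillator_abs_powr_derivative[OF \<alpha> xu(3)]])
  from global_antiderivative[OF this, of y\<^sub>0]
  obtain y where y: "y 0 = y\<^sub>0" "\<And>t. (y has_real_derivative v * \<bar>x t\<bar> powr (2 * \<alpha>)) (at t)"
    by (auto simp: has_real_derivative_iff_has_vector_derivative)
  from grushin_exp_eq[OF \<alpha> xu(3) y(2)] xu y that show ?thesis by auto
qed

text \<open>This is the identity \<open>(1 + \<alpha>) v y' = 2H - (x u)'\<close>, which makes the quadrature for \<open>y\<close> explicit.\<close>

lemma oscillator_moment_derivative:
  assumes "\<alpha> \<ge> 1" "oscillator \<alpha> v x u"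
    and e: "e = (u 0)\<^sup>2 + v\<^sup>2 * \<bar>x 0\<bar> powr (2 * \<alpha>)"
  shows "((\<lambda>t. e * t - x t * u t) has_real_derivative (1 + \<alpha>) * v\<^sup>2 * \<bar>x t\<bar> powr (2 * \<alpha>)) (at t)"
proof -
  have "((\<lambda>t. e * t - x t * u t) has_real_derivative
      e - (u t * u t + - (\<alpha> * v\<^sup>2 * (\<bar>x t\<bar> powr (2 * (\<alpha> - 1)) * x t)) * x t)) (at t)"
    by (rule derivative_eq_intros oscillatorD(1,2)[OF assms(2)] refl | simp)+
  moreover have "e - (u t * u t + - (\<alpha> * v\<^sup>2 * (\<bar>x t\<bar> powr (2 * (\<alpha> - 1)) * x t)) * x t) =
      (1 + \<alpha>) * v\<^sup>2 * \<bar>x t\<bar> powr (2 * \<alpha>)"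
    using oscillator_energy[OF assms(1,2), of t] abs_powr_twice_split[of "x t" \<alpha>]
    by (simp add: e algebra_simps power2_eq_square)
  ultimately show ?thesis by simp
qed

text \<open>The extremal obtained from \<open>x\<close> by the dilation \<open>a\<close>, the time
  shift \<open>s\<close> and the time rescaling \<open>w\<close>. Its \<open>y\<close> coordinate
  grows at the rate \<open>v * w * a powr (1 - \<alpha>) * \<bar>a * x\<bar> powr (2 *
  \<alpha>)\<close>, a constant multiple of the derivative of \<open>K\<close> along the rescaled
  time. Fixing the base point by \<open>a * x s = x\<^sub>0\<close> constrains the three parameters
  to the two dimensions of the cotangent space.\<close>

lemma grushin_exp_family:
  assumes \<alpha>: "\<alpha> \<ge> 1" and o: "oscillator \<alpha> v x u" and v: "v \<noteq> 0" and a: "a > 0"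
    and e: "e = (u 0)\<^sup>2 + v\<^sup>2 * \<bar>x 0\<bar> powr (2 * \<alpha>)"
    and K: "\<And>t. K t = e * t - x t * u t"
  shows "grushin_exp \<alpha> (a * x s, y\<^sub>0) (a * w * u s, v * w * a powr (1 - \<alpha>)) =
    (a * x (s + w), y\<^sub>0 + a powr (1 + \<alpha>) / ((1 + \<alpha>) * v) * (K (s + w) - K s))"
proof -
  have dK: "(K has_real_derivative (1 + \<alpha>) * v\<^sup>2 * \<bar>x t\<bar> powr (2 * \<alpha>)) (at t)" for t
    unfolding K[abs_def] by (rule oscillator_moment_derivative[OF \<alpha> o e])
  define y where "y t = y\<^sub>0 + a powr (1 + \<alpha>) / ((1 + \<alpha>) * v) * (K (s + w * t) - K s)" for t
  have lin: "((\<lambda>t. s + w * t) has_real_derivative w) (at t)" for t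
    by (auto intro!: derivative_eq_intros)
  have dy: "(y has_real_derivative v * w * a powr (1 - \<alpha>) * \<bar>a * x (s + w * t)\<bar> powr (2 * \<alpha>)) (at t)" for t
  proof -
    have "a powr (1 + \<alpha>) = a powr (1 - \<alpha>) * a powr (2 * \<alpha>)"
      unfolding powr_add[symmetric] by (simp add: algebra_simps)
    then have eq: "a powr (1 + \<alpha>) / ((1 + \<alpha>) * v) * ((1 + \<alpha>) * v\<^sup>2 * \<bar>x (s + w * t)\<bar> powr (2 * \<alpha>) * w) =
        v * w * a powr (1 - \<alpha>) * \<bar>a * x (s + w * t)\<bar> powr (2 * \<alpha>)"
      using v a \<alpha> by (simp add: abs_mult powr_mult power2_eq_square)
    have "(y has_real_derivative
        a powr (1 + \<alpha>) / ((1 + \<alpha>) * v) * ((1 + \<alpha>) * v\<^sup>2 * \<bar>x (s + w * t)\<bar> powr (2 * \<alpha>) * w)) (at t)"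
      unfolding y_def
      by (rule derivative_eq_intros DERIV_chain2[OF dK lin] refl | simp)+
    then show ?thesis unfolding eq .
  qed
  from grushin_exp_eq[OF \<alpha> oscillator_scale_shift[OF o a] dy] show ?thesis
    by (simp add: y_def)
qed

section \<open>Differentiability of the exponential map\<close>

text \<open>The inverse function theorem in one dimension. It recovers the time from the position
  while the solution is moving; shrinking to \<open>u t \<noteq> 0\<close> keeps the inverse
  differentiable on all of \<open>T\<close>.\<close>

lemma real_local_inverse:
  fixes x u :: "real \<Rightarrow> real"
  assumes dx: "\<And>t. (x has_real_derivative u t) (at t)" and cu: "continuous_on UNIV u"
    and p: "u p \<noteq> 0"
  obtains S T g where "open S" "p \<in> S" "open T" "x p \<in> T"
    "\<And>t. t \<in> S \<Longrightarrow> x t \<in> T \<and> g (x t) = t \<and> u t \<noteq> 0"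
    "\<And>z. z \<in> T \<Longrightarrow> g z \<in> S \<and> x (g z) = z \<and> (g has_real_derivative inverse (u (g z))) (at z)"
proof -
  define f' where "f' t = (blinfun_scaleR_right (u t) :: real \<Rightarrow>\<^sub>L real)" for t
  have f': "blinfun_apply (f' t) = (*) (u t)" for t by (auto simp: f'_def)
  have "open (u -` (- {0}) \<inter> UNIV)"
    by (intro continuous_on_open_vimage[THEN iffD1, rule_format] cu) auto
  then have op: "open {t. u t \<noteq> 0}" by (simp add: vimage_def)
  have der: "(x has_derivative blinfun_apply (f' t)) (at t)" for t
    using dx[of t] by (simp add: f' has_field_derivative_def)
  have cont: "continuous_on {t. u t \<noteq> 0} f'"
    by (rule continuous_on_blinfun_componentwise)
      (auto simp: f' intro!: continuous_intros continuous_on_subset[OF cu])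
  have inv: "blinfun_scaleR_right (inverse (u p)) o\<^sub>L f' p = (id_blinfun :: real \<Rightarrow>\<^sub>L real)"
    using p by (intro blinfun_eqI) (simp add: f')
  have "p \<in> {t. u t \<noteq> 0}" using p by simp
  then show ?thesis
  proof (rule inverse_function_theorem[OF op der cont _ inv])
    fix S T g g'
    assume S: "open S" "S \<subseteq> {t. u t \<noteq> 0}" "p \<in> S"
      and T: "open T" "x p \<in> T" and hom: "homeomorphism S T x g"
      and g: "\<And>y. y \<in> T \<Longrightarrow> (g has_derivative g' y) (at y)"
        "\<And>y. y \<in> T \<Longrightarrow> g' y = inv (blinfun_apply (f' (g y)))"
    have ST: "x t \<in> T \<and> g (x t) = t" if "t \<in> S" for t
      using hom that by (auto simp: homeomorphism_def)
    have TS: "g z \<in> S \<and> x (g z) = z" if "z \<in> T" for z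
      using hom that by (auto simp: homeomorphism_def)
    have "(g has_real_derivative inverse (u (g z))) (at z)" if z: "z \<in> T" for z
    proof -
      have "u (g z) \<noteq> 0" using TS[OF z] S by auto
      then have "inv ((*) (u (g z))) = (*) (inverse (u (g z)))"
        by (intro inv_unique_comp) (auto simp: fun_eq_iff)
      then show ?thesis
        using g[OF z] by (simp add: f' has_field_derivative_def)
    qed
    with S T ST TS show thesis
      by (intro that[of S T g]) auto
  qed
qed

text \<open>The components of \<open>M\<close> are the dilation and the time shift of the given solution.\<close>

lemma oscillator_polar_inverse:
  assumes \<alpha>: "\<alpha> \<ge> 1" and o: "oscillator \<alpha> v x u"
    and e: "(u 0)\<^sup>2 + v\<^sup>2 * \<bar>x 0\<bar> powr (2 * \<alpha>) \<noteq> 0"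
  obtains W M where "open W" "(x 0, u 0) \<in> W" "M differentiable (at (x 0, u 0))" "M (x 0, u 0) = (1, 0)"
    "\<And>z. z \<in> W \<Longrightarrow> fst (M z) > 0 \<and> fst (M z) * x (snd (M z)) = fst z \<and>
       fst (M z) powr \<alpha> * u (snd (M z)) = snd z"
proof -
  define u' where "u' t = - (\<alpha> * v\<^sup>2 * (\<bar>x t\<bar> powr (2 * (\<alpha> - 1)) * x t))" for t
  have dx: "(x has_real_derivative u t) (at t)" and du: "(u has_real_derivative u' t) (at t)" for t
    using oscillatorD(1,2)[OF o] by (auto simp: u'_def)
  have cx: "continuous_on UNIV x" and cu: "continuous_on UNIV u"
    by (auto intro!: continuous_at_imp_continuous_on oscillatorD(3,4)[OF o])
  have cu': "continuous_on UNIV u'"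
    unfolding u'_def
    by (intro continuous_intros continuous_on_compose2[OF continuous_on_abs_powr_mult cx]) (use \<alpha> in auto)
  \<comment> \<open>The map from dilation and time shift to the phase plane. The velocity carries
    the power \<alpha> because a dilation by \<open>a\<close> leaves the parameter \<open>v\<close>
    fixed exactly when \<open>w = a powr (\<alpha> - 1)\<close>, and then
    \<open>a * w = a powr \<alpha>\<close>.\<close>
  define N where "N p = (fst p * x (snd p), fst p powr \<alpha> * u (snd p))" for p :: "real \<times> real"
  define D where "D p h = (fst h * x (snd p) + fst p * (u (snd p) * snd h),
      \<alpha> * fst p powr (\<alpha> - 1) * fst h * u (snd p) + fst p powr \<alpha> * (u' (snd p) * snd h))"
    for p h :: "real \<times> real"
  define U :: "(real \<times> real) set" where "U = {0<..} \<times> UNIV"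
  have dN: "(N has_derivative D p) (at p)" if "p \<in> U" for p
  proof -
    have p: "fst p > 0" using that by (auto simp: U_def)
    have 1: "((\<lambda>p. x (snd p)) has_derivative (\<lambda>h. snd h * u (snd p))) (at p)"
      and 2: "((\<lambda>p. u (snd p)) has_derivative (\<lambda>h. snd h * u' (snd p))) (at p)" for p :: "real \<times> real"
      by (rule DERIV_compose_FDERIV[OF dx has_derivative_snd[OF has_derivative_ident]]
          DERIV_compose_FDERIV[OF du has_derivative_snd[OF has_derivative_ident]])+
    have 3: "((\<lambda>p. fst p powr \<alpha>) has_derivative (\<lambda>h. fst h * (\<alpha> * fst p powr (\<alpha> - 1)))) (at p)"
      by (rule DERIV_compose_FDERIV[OF has_real_derivative_powr[OF p] has_derivative_fst[OF has_derivative_ident]])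
    show ?thesis
      unfolding N_def D_def
      by (rule has_derivative_eq_rhs, (rule derivative_intros 1 2 3)+) (auto simp: algebra_simps)
  qed
  have bl: "bounded_linear (D p)" for p :: "real \<times> real"
  proof -
    have "bounded_linear (\<lambda>h. (fst h * x (snd p) + fst p * (u (snd p) * snd h),
      \<alpha> * fst p powr (\<alpha> - 1) * fst h * u (snd p) + fst p powr \<alpha> * (u' (snd p) * snd h)))"
      by (intro bounded_linear_intros)
    then show ?thesis by (simp add: D_def[abs_def])
  qed
  define f' where "f' p = Blinfun (D p)" for p :: "real \<times> real"
  have f': "blinfun_apply (f' p) = D p" for p
    by (simp add: f'_def bounded_linear_Blinfun_apply bl)
  \<comment> \<open>The Jacobian determinant of \<open>N\<close> at \<open>(1, 0)\<close>. It equals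
    -2\<alpha> times the Hamiltonian and is therefore nonzero; \<open>I\<close> is the inverse given
    by Cramer's rule.\<close>
  define det where "det = x 0 * u' 0 - \<alpha> * (u 0)\<^sup>2"
  have "det = - \<alpha> * ((u 0)\<^sup>2 + v\<^sup>2 * (\<bar>x 0\<bar> powr (2 * (\<alpha> - 1)) * x 0 * x 0))"
    by (simp add: det_def u'_def algebra_simps)
  then have "det = - \<alpha> * ((u 0)\<^sup>2 + v\<^sup>2 * \<bar>x 0\<bar> powr (2 * \<alpha>))"
    unfolding abs_powr_twice_split .
  then have det: "det \<noteq> 0" using e \<alpha> by simp
  define I where "I h = ((u' 0 * fst h - u 0 * snd h) / det, (x 0 * snd h - \<alpha> * u 0 * fst h) / det)"
    for h :: "real \<times> real"
  have "bounded_linear (\<lambda>h. (u' 0 / det * fst h - u 0 / det * snd h, x 0 / det * snd h - \<alpha> * u 0 / det * fst h))"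
    by (intro bounded_linear_intros)
  then have blI: "bounded_linear I"
    by (simp add: I_def[abs_def] diff_divide_distrib)
  have "Blinfun I o\<^sub>L f' (1, 0) = id_blinfun"
  proof (rule blinfun_eqI)
    fix h :: "real \<times> real"
    have "I (D (1, 0) h) = (fst h * det / det, snd h * det / det)"
      unfolding I_def D_def det_def by (simp add: algebra_simps power2_eq_square)
    then show "blinfun_apply (Blinfun I o\<^sub>L f' (1, 0)) h = blinfun_apply id_blinfun h"
      using det by (simp add: f' bounded_linear_Blinfun_apply blI)
  qed
  moreover have "open U" by (auto simp: U_def intro!: open_Times)
  moreover have "continuous_on U f'"
  proof (rule continuous_on_blinfun_componentwise)
    fix i :: "real \<times> real"
    have [continuous_intros]: "continuous_on U (\<lambda>p. x (snd p))" "continuous_on U (\<lambda>p. u (snd p))"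
      "continuous_on U (\<lambda>p. u' (snd p))"
      by (auto intro!: continuous_on_compose2[OF cx] continuous_on_compose2[OF cu]
          continuous_on_compose2[OF cu'] continuous_intros)
    show "continuous_on U (\<lambda>p. blinfun_apply (f' p) i)"
      unfolding f' D_def by (intro continuous_intros) (auto simp: U_def)
  qed
  moreover have "(1, 0) \<in> U" by (simp add: U_def)
  ultimately obtain U' V g g' where U': "U' \<subseteq> U" "(1, 0) \<in> U'" "open V" "N (1, 0) \<in> V"
    and hom: "homeomorphism U' V N g" and g: "\<And>y. y \<in> V \<Longrightarrow> (g has_derivative g' y) (at y)"
    using inverse_function_theorem[of U N f' "(1, 0)"] dN unfolding f' by metis
  have N10: "N (1, 0) = (x 0, u 0)" by (simp add: N_def)
  show ?thesis
  proof (rule that[of V g])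
    show "g (x 0, u 0) = (1, 0)" using hom U' by (metis N10 homeomorphism_def)
    show "g differentiable (at (x 0, u 0))" using g[OF U'(4)] unfolding N10 differentiable_def by blast
    fix z assume "z \<in> V"
    then have "g z \<in> U" "N (g z) = z" using hom U'(1) by (auto simp: homeomorphism_def)
    then show "fst (g z) > 0 \<and> fst (g z) * x (snd (g z)) = fst z \<and> fst (g z) powr \<alpha> * u (snd (g z)) = snd z"
      unfolding N_def U_def by auto
  qed (use U' N10 in auto)
qed

text \<open>Near the given covector the parameters of the rescaled family can be solved for
  differentiably: a change of time scale brings the second component back to \<open>v\<close>, and
  the local inverse \<open>M\<close> then supplies the dilation and the shift. The exponential map
  is locally the resulting explicit formula \<open>\<Phi>\<close>.\<close>

lemma grushin_exp_differentiable:
  assumes \<alpha>: "\<alpha> \<ge> 1" and o: "oscillator \<alpha> v x u" and v: "v \<noteq> 0"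
    and e: "(u 0)\<^sup>2 + v\<^sup>2 * \<bar>x 0\<bar> powr (2 * \<alpha>) \<noteq> 0"
  shows "grushin_exp \<alpha> (x 0, y\<^sub>0) differentiable (at (u 0, v))"
proof -
  obtain W M where W: "open W" "(x 0, u 0) \<in> W" and M: "M differentiable (at (x 0, u 0))" "M (x 0, u 0) = (1, 0)"
    and WM: "\<And>z. z \<in> W \<Longrightarrow> fst (M z) > 0 \<and> fst (M z) * x (snd (M z)) = fst z \<and>
       fst (M z) powr \<alpha> * u (snd (M z)) = snd z"
    using oscillator_polar_inverse[OF \<alpha> o e] by blast
  obtain M' where M': "(M has_derivative M') (at (x 0, u 0))" using M(1) unfolding differentiable_def by blast
  \<comment> \<open>The initial phase point after the time rescaling that turns the second component
    \<open>snd l\<close> into \<open>v\<close>.\<close>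
  define z where "z l = (x 0, v * fst l / snd l)" for l :: "real \<times> real"
  have z0: "z (u 0, v) = (x 0, u 0)" using v by (simp add: z_def)
  have "\<exists>z'. (z has_derivative z') (at (u 0, v))"
    unfolding z_def using v by (intro exI) (rule derivative_intros | simp)+
  then obtain z' where z': "(z has_derivative z') (at (u 0, v))" by blast
  \<comment> \<open>The factor \<open>w\<close> is forced by the second component: it makes
    \<open>v * w l * a l powr (1 - \<alpha>)\<close> equal to \<open>snd l\<close>.\<close>
  define a s w where "a l = fst (M (z l))" and "s l = snd (M (z l))"
    and "w l = snd l / v * (fst (M (z l)) powr (\<alpha> - 1))" for l
  have "((\<lambda>l. M (z l)) has_derivative (\<lambda>h. M' (z' h))) (at (u 0, v))"
    by (rule has_derivative_compose[OF z']) (simp add: z0 M')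
  note Mz = has_derivative_fst[OF this] has_derivative_snd[OF this]
  from Mz have da: "(a has_derivative (\<lambda>h. fst (M' (z' h)))) (at (u 0, v))"
    and ds: "(s has_derivative (\<lambda>h. snd (M' (z' h)))) (at (u 0, v))"
    by (simp_all add: a_def[abs_def] s_def[abs_def])
  have a0: "a (u 0, v) = 1" by (simp add: a_def z0 M(2))
  have powr: "\<exists>D. ((\<lambda>l. a l powr r) has_derivative D) (at (u 0, v))" for r
    by (intro exI, rule DERIV_compose_FDERIV[OF has_real_derivative_powr da]) (simp add: a0)
  obtain P where P: "((\<lambda>l. a l powr (\<alpha> - 1)) has_derivative P) (at (u 0, v))" using powr by blast
  obtain Q where Q: "((\<lambda>l. a l powr (1 + \<alpha>)) has_derivative Q) (at (u 0, v))" using powr by blast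
  have "\<exists>w'. (w has_derivative w') (at (u 0, v))"
    unfolding w_def a_def[symmetric] by (intro exI) (rule derivative_intros P | simp add: v)+
  then obtain w' where dw: "(w has_derivative w') (at (u 0, v))" by blast
  define e where "e = (u 0)\<^sup>2 + v\<^sup>2 * \<bar>x 0\<bar> powr (2 * \<alpha>)"
  define K where "K t = e * t - x t * u t" for t
  have dK: "(K has_real_derivative (1 + \<alpha>) * v\<^sup>2 * \<bar>x t\<bar> powr (2 * \<alpha>)) (at t)" for t
    unfolding K_def by (rule oscillator_moment_derivative[OF \<alpha> o e_def])
  define \<Phi> where "\<Phi> l = (a l * x (s l + w l), y\<^sub>0 + a l powr (1 + \<alpha>) / ((1 + \<alpha>) * v) * (K (s l + w l) - K (s l)))"
    for l
  note dsw = has_derivative_add[OF ds dw]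
  have "\<exists>D. (\<Phi> has_derivative D) (at (u 0, v))"
    unfolding \<Phi>_def divide_inverse
    by (intro exI) (rule derivative_intros Q da DERIV_compose_FDERIV[OF dK ds] DERIV_compose_FDERIV[OF dK dsw]
        DERIV_compose_FDERIV[OF oscillatorD(1)[OF o] dsw])+
  then obtain D where D: "(\<Phi> has_derivative D) (at (u 0, v))" by blast
  have "isCont z (u 0, v)" using z' by (rule has_derivative_continuous)
  then have "(z \<longlongrightarrow> z (u 0, v)) (nhds (u 0, v))"
    unfolding isCont_def tendsto_at_iff_tendsto_nhds .
  then have "\<forall>\<^sub>F l in nhds (u 0, v). z l \<in> W"
    using W by (intro topological_tendstoD) (simp_all add: z0)
  moreover have "\<forall>\<^sub>F l in nhds (u 0, v). snd l \<noteq> 0"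
    using v by (intro eventually_nhds[THEN iffD2] exI[of _ "UNIV \<times> - {0}"]) (auto intro!: open_Times)
  ultimately have ev: "\<forall>\<^sub>F l in nhds (u 0, v). \<Phi> l = grushin_exp \<alpha> (x 0, y\<^sub>0) l"
  proof eventually_elim
    case (elim l)
    note m = WM[OF elim(1), folded a_def s_def]
    have p: "a l powr \<alpha> = a l * a l powr (\<alpha> - 1)" "a l powr (\<alpha> - 1) * a l powr (1 - \<alpha>) = 1"
      using m powr_add[of "a l" 1 "\<alpha> - 1"] powr_add[of "a l" "\<alpha> - 1" "1 - \<alpha>"] by auto
    have "a l * w l * u (s l) = snd l / v * (a l powr \<alpha> * u (s l))"
      by (simp add: w_def a_def[symmetric] p(1))
    also have "\<dots> = fst l" using m v elim(2) by (simp add: z_def)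
    finally have 1: "a l * w l * u (s l) = fst l" .
    have "v * w l * a l powr (1 - \<alpha>) = snd l * (a l powr (\<alpha> - 1) * a l powr (1 - \<alpha>))"
      using v by (simp add: w_def a_def[symmetric])
    then have 2: "v * w l * a l powr (1 - \<alpha>) = snd l" by (simp add: p(2))
    have 3: "a l * x (s l) = x 0" using m by (simp add: z_def)
    from grushin_exp_family[OF \<alpha> o v, of "a l" e K "s l" y\<^sub>0 "w l"] m
    show ?case unfolding 1 2 3 by (simp add: \<Phi>_def e_def K_def)
  qed
  then have "(grushin_exp \<alpha> (x 0, y\<^sub>0) has_derivative D) (at (u 0, v))"
    using D by (intro has_derivative_transform_eventually[OF D])
      (auto intro: eventually_nhds_x_imp_x filter_leD[OF at_le] elim: eventually_mono
        simp: eventually_nhds_conv_at)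
  then show ?thesis unfolding differentiable_def by blast
qed

section \<open>Curves, kernels and level sets\<close>

text \<open>The chain rule, in the form in which it is used: the differential is evaluated on a
  vector by following a tangent curve along which the map is explicit.\<close>

lemma frechet_derivative_along_curve:
  assumes f: "f differentiable (at (c s))" and c: "(c has_vector_derivative c') (at s)"
    and fc: "\<forall>\<^sub>F t in nhds s. f (c t) = (P t, Q t)"
    and P: "(P has_real_derivative p) (at s)" and Q: "(Q has_real_derivative q) (at s)"
  shows "frechet_derivative f (at (c s)) c' = (p, q :: real)"
proof -
  have "((\<lambda>t. f (c t)) has_derivative (\<lambda>h. frechet_derivative f (at (c s)) (h *\<^sub>R c'))) (at s)"
    using c f by (intro has_derivative_compose[OF _ frechet_derivative_works[THEN iffD1]])
      (auto simp: has_vector_derivative_def)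
  moreover have "linear (frechet_derivative f (at (c s)))" using f by (rule linear_frechet_derivative)
  ultimately have 1: "((\<lambda>t. f (c t)) has_vector_derivative frechet_derivative f (at (c s)) c') (at s)"
    by (simp add: has_vector_derivative_def linear_scale)
  have "((\<lambda>t. (P t, Q t)) has_vector_derivative (p, q)) (at s)"
    using P Q by (intro has_vector_derivative_Pair) (auto simp: has_real_derivative_iff_has_vector_derivative)
  moreover have "((\<lambda>t. (P t, Q t)) has_vector_derivative frechet_derivative f (at (c s)) c') (at s)"
  proof -
    obtain A where A: "open A" "s \<in> A" "\<And>t. t \<in> A \<Longrightarrow> f (c t) = (P t, Q t)"
      using fc unfolding eventually_nhds by blast
    show ?thesis by (rule has_vector_derivative_transform_within_open[OF 1 A])
  qed
  ultimately show ?thesis by (metis vector_derivative_unique_at)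
qed

text \<open>The determinant of the two images is the determinant of \<open>E\<close> times that of
  \<open>w\<close> and \<open>w'\<close>. If it is nonzero then so is the determinant of
  \<open>E\<close>, and Cramer's rule kills every kernel vector.\<close>

lemma linear_kernel_trivial_if_independent:
  fixes E :: "real \<times> real \<Rightarrow> real \<times> real"
  assumes "linear E" and w: "E w = (p, q)" "E w' = (r, s)" and ne: "p * s - q * r \<noteq> 0"
  shows "{h. E h = 0} = {0}"
proof -
  define A B where "A = E (1, 0)" and "B = E (0, 1)"
  have E: "E h = (fst h * fst A + snd h * fst B, fst h * snd A + snd h * snd B)" for h
  proof -
    have "h = fst h *\<^sub>R (1, 0) + snd h *\<^sub>R (0, 1)" by (simp add: prod_eq_iff)
    then have "E h = E (fst h *\<^sub>R (1, 0) + snd h *\<^sub>R (0, 1))" by (rule arg_cong)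
    also have "\<dots> = fst h *\<^sub>R A + snd h *\<^sub>R B"
      unfolding A_def B_def linear_add[OF assms(1)] linear_scale[OF assms(1)] ..
    finally have "E h = fst h *\<^sub>R A + snd h *\<^sub>R B" .
    then show ?thesis by (intro prod_eqI) (auto simp: algebra_simps)
  qed
  define d where "d = fst A * snd B - snd A * fst B"
  have "p * s - q * r = d * (fst w * snd w' - snd w * fst w')"
    using w unfolding E d_def by (auto simp: algebra_simps)
  then have d: "d \<noteq> 0" using ne by auto
  have "h = 0" if h: "E h = 0" for h
  proof -
    have c: "fst h * fst A + snd h * fst B = 0" "fst h * snd A + snd h * snd B = 0"
      using h by (simp_all add: E zero_prod_def)
    have "d * fst h = (fst h * fst A + snd h * fst B) * snd B - (fst h * snd A + snd h * snd B) * fst B"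
      "d * snd h = (fst h * snd A + snd h * snd B) * fst A - (fst h * fst A + snd h * fst B) * snd A"
      by (simp_all add: d_def algebra_simps)
    then have "d * fst h = 0" "d * snd h = 0" unfolding c by simp_all
    with d show ?thesis by (simp add: prod_eq_iff)
  qed
  moreover have "E 0 = 0" using assms(1) by (rule linear_0)
  ultimately show ?thesis by auto
qed

text \<open>If all levels were injective, each would be strictly monotone by continuity, increasing
  for \<open>k < k\<^sub>0\<close> and decreasing for \<open>k > k\<^sub>0\<close> by the sign of
  the derivative at the single point \<open>a\<^sub>0\<close>. Comparing the values at the two ends
  of the interval and passing to the limit from both sides makes them equal at
  \<open>k\<^sub>0\<close>, against injectivity there.\<close>

lemma not_inj_on_level_if_derivative_changes_sign:
  fixes F :: "real \<Rightarrow> real \<Rightarrow> real"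
  assumes "\<delta> > 0"
    and cont: "\<And>k. \<bar>k - k\<^sub>0\<bar> < \<delta> \<Longrightarrow> continuous_on {a\<^sub>0 - \<delta>..a\<^sub>0 + \<delta>} (\<lambda>a. F a k)"
    and contk: "\<And>a. a \<in> {a\<^sub>0 - \<delta>, a\<^sub>0 + \<delta>} \<Longrightarrow> isCont (F a) k\<^sub>0"
    and der: "\<And>k. \<bar>k - k\<^sub>0\<bar> < \<delta> \<Longrightarrow> ((\<lambda>a. F a k) has_real_derivative d k) (at a\<^sub>0)"
    and pos: "\<And>k. k\<^sub>0 - \<delta> < k \<Longrightarrow> k < k\<^sub>0 \<Longrightarrow> d k > 0"
    and neg: "\<And>k. k\<^sub>0 < k \<Longrightarrow> k < k\<^sub>0 + \<delta> \<Longrightarrow> d k < 0"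
  shows "\<exists>k. \<bar>k - k\<^sub>0\<bar> < \<delta> \<and> \<not> inj_on (\<lambda>a. F a k) {a\<^sub>0 - \<delta>..a\<^sub>0 + \<delta>}"
proof (rule ccontr)
  assume "\<not> ?thesis"
  then have inj: "inj_on (\<lambda>a. F a k) {a\<^sub>0 - \<delta>..a\<^sub>0 + \<delta>}" if "\<bar>k - k\<^sub>0\<bar> < \<delta>" for k using that by blast
  have mono: "(F (a\<^sub>0 - \<delta>) k < F a k \<and> F a k < F (a\<^sub>0 + \<delta>) k) \<or> (F (a\<^sub>0 + \<delta>) k < F a k \<and> F a k < F (a\<^sub>0 - \<delta>) k)"
    if "\<bar>k - k\<^sub>0\<bar> < \<delta>" "a\<^sub>0 - \<delta> < a" "a < a\<^sub>0 + \<delta>" for a k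
    using continuous_inj_imp_mono[OF that(2,3) cont inj] that(1) by blast
  \<comment> \<open>Betweenness on the shorter interval ending at \<open>a\<close> links the local
    growth to the right of \<open>a\<^sub>0\<close> with the value at the left end, and so with the
    direction of monotonicity on the whole interval.\<close>
  have mono': "(F (a\<^sub>0 - \<delta>) k < F a\<^sub>0 k \<and> F a\<^sub>0 k < F a k) \<or> (F a k < F a\<^sub>0 k \<and> F a\<^sub>0 k < F (a\<^sub>0 - \<delta>) k)"
    if "\<bar>k - k\<^sub>0\<bar> < \<delta>" "a\<^sub>0 < a" "a < a\<^sub>0 + \<delta>" for a k
  proof -
    have "{a\<^sub>0 - \<delta>..a} \<subseteq> {a\<^sub>0 - \<delta>..a\<^sub>0 + \<delta>}" using that by auto
    then show ?thesis
      using continuous_inj_imp_mono[of "a\<^sub>0 - \<delta>" a\<^sub>0 a "\<lambda>a. F a k"] that \<open>\<delta> > 0\<close>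
        continuous_on_subset[OF cont[OF that(1)]] inj_on_subset[OF inj[OF that(1)]] by auto
  qed
  have right: "\<exists>a. a\<^sub>0 < a \<and> a < a\<^sub>0 + \<delta> \<and> g a > g a\<^sub>0"
    if g: "(g has_real_derivative D) (at a\<^sub>0)" "D > 0" for g :: "real \<Rightarrow> real" and D
  proof -
    obtain r where r: "r > 0" "\<And>h. 0 < h \<Longrightarrow> h < r \<Longrightarrow> g a\<^sub>0 < g (a\<^sub>0 + h)"
      using DERIV_pos_inc_right[OF g] by blast
    then show ?thesis using \<open>\<delta> > 0\<close>
      by (intro exI[of _ "a\<^sub>0 + min r \<delta> / 2"]) auto
  qed
  have up: "F (a\<^sub>0 - \<delta>) k \<le> F (a\<^sub>0 + \<delta>) k" if "k\<^sub>0 - \<delta> < k" "k < k\<^sub>0" for k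
  proof -
    have k: "\<bar>k - k\<^sub>0\<bar> < \<delta>" and dk: "d k > 0" using that pos by auto
    obtain a where a: "a\<^sub>0 < a" "a < a\<^sub>0 + \<delta>" "F a k > F a\<^sub>0 k" using right[OF der[OF k] dk] by blast
    show ?thesis using mono'[OF k a(1,2)] mono[OF k, of a\<^sub>0] a \<open>\<delta> > 0\<close> by auto
  qed
  have down: "F (a\<^sub>0 - \<delta>) k \<ge> F (a\<^sub>0 + \<delta>) k" if "k\<^sub>0 < k" "k < k\<^sub>0 + \<delta>" for k
  proof -
    have k: "\<bar>k - k\<^sub>0\<bar> < \<delta>" and dk: "- d k > 0" using that neg by auto
    obtain a where a: "a\<^sub>0 < a" "a < a\<^sub>0 + \<delta>" "- F a k > - F a\<^sub>0 k"
      using right[OF DERIV_minus[OF der[OF k]] dk] by blast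
    show ?thesis using mono'[OF k a(1,2)] mono[OF k, of a\<^sub>0] a \<open>\<delta> > 0\<close> by auto
  qed
  define g where "g k = F (a\<^sub>0 + \<delta>) k - F (a\<^sub>0 - \<delta>) k" for k
  have "isCont g k\<^sub>0" unfolding g_def using contk by (intro continuous_intros) auto
  then have lim: "(g \<longlongrightarrow> g k\<^sub>0) (at_left k\<^sub>0)" "(g \<longlongrightarrow> g k\<^sub>0) (at_right k\<^sub>0)"
    by (simp_all add: isCont_def filterlim_at_split)
  have "\<forall>\<^sub>F k in at_left k\<^sub>0. g k \<ge> 0"
    using up \<open>\<delta> > 0\<close> unfolding g_def eventually_at_left_field by (intro exI[of _ "k\<^sub>0 - \<delta>"]) auto
  then have "g k\<^sub>0 \<ge> 0" by (intro tendsto_lowerbound[OF lim(1)]) auto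
  moreover have "\<forall>\<^sub>F k in at_right k\<^sub>0. g k \<le> 0"
    using down \<open>\<delta> > 0\<close> unfolding g_def eventually_at_right_field by (intro exI[of _ "k\<^sub>0 + \<delta>"]) auto
  then have "g k\<^sub>0 \<le> 0" by (intro tendsto_upperbound[OF lim(2)]) auto
  ultimately have "g k\<^sub>0 = 0" by simp
  then show False using mono[of k\<^sub>0 a\<^sub>0] \<open>\<delta> > 0\<close> by (auto simp: g_def)
qed

section \<open>Horizontal and stationary covectors\<close>

text \<open>On the singular axis with zero velocity the constant curve is an extremal whatever
  \<open>v\<close> is, so a whole line of covectors is collapsed to one point.\<close>

lemma grushin_exp_stationary:
  assumes \<alpha>: "\<alpha> \<ge> 1"
  shows "grushin_exp \<alpha> (0, y\<^sub>0) (0, v) = (0, y\<^sub>0)"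
  using grushin_exp_eq[OF \<alpha>, of v "\<lambda>_. 0" "\<lambda>_. 0" "\<lambda>_. y\<^sub>0"] by (simp add: oscillator_def)

lemma abs_increment_le:
  fixes f :: "real \<Rightarrow> real"
  assumes f: "\<And>t. (f has_real_derivative f' t) (at t)" and b: "\<And>t. 0 \<le> t \<Longrightarrow> t \<le> 1 \<Longrightarrow> \<bar>f' t\<bar> \<le> B"
    and s: "0 \<le> s" "s \<le> 1"
  shows "\<bar>f s - f 0\<bar> \<le> B"
proof -
  have "norm (f s - f 0) \<le> B * norm (s - 0)"
  proof (rule field_differentiable_bound[of "{0..1}" f f'])
    show "(f has_field_derivative f' t) (at t within {0..1})" for t
      using f by (rule has_field_derivative_at_within)
  qed (use b s in auto)
  moreover have "B * s \<le> B" using b[of 0] s by (simp add: mult_left_le)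
  ultimately show ?thesis using s by simp
qed

text \<open>The dilation family requires \<open>v \<noteq> 0\<close>, so at \<open>v = 0\<close> the
  differential is computed by perturbing the straight line \<open>r\<close>. The force is of order
  \<open>v\<^sup>2\<close>, hence the horizontal coordinate changes only to second order, and to
  first order \<open>y\<close> grows by \<open>v\<close> times the integral \<open>J\<close> of
  \<open>\<bar>r t\<bar> powr (2 * \<alpha>)\<close> over the unit interval.\<close>

lemma grushin_exp_derivative_horizontal:
  assumes \<alpha>: "\<alpha> \<ge> 1" and ne: "x\<^sub>0 \<noteq> 0 \<or> u\<^sub>0 \<noteq> 0"
  obtains J where "J > 0"
    "(grushin_exp \<alpha> (x\<^sub>0, y\<^sub>0) has_derivative (\<lambda>h. (fst h, J * snd h))) (at (u\<^sub>0, 0))"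
proof -
  define r where "r t = x\<^sub>0 + u\<^sub>0 * t" for t
  have dr: "(r has_real_derivative u\<^sub>0) (at t)" for t
    unfolding r_def by (auto intro!: derivative_eq_intros)
  have "continuous_on UNIV (\<lambda>t. \<bar>r t\<bar> powr (2 * \<alpha>))"
    using \<alpha> unfolding r_def by (intro continuous_intros continuous_on_powr') auto
  from global_antiderivative[OF this, of 0]
  obtain I where I0: "I 0 = 0" and dI: "\<And>t. (I has_real_derivative \<bar>r t\<bar> powr (2 * \<alpha>)) (at t)"
    by (auto simp: has_real_derivative_iff_has_vector_derivative)
  define J where "J = I 1"
  have "J > 0"
  proof -
    \<comment> \<open>Mean values on the two halves give distinct times; a line that is not
      identically zero cannot vanish at both, so the integral is positive.\<close>
    obtain s t where s: "0 < s" "s < 1/2" "I (1/2) - I 0 = (1/2 - 0) * \<bar>r s\<bar> powr (2 * \<alpha>)"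
      and t: "1/2 < t" "t < 1" "I 1 - I (1/2) = (1 - 1/2) * \<bar>r t\<bar> powr (2 * \<alpha>)"
      using MVT2[of 0 "1/2" I "\<lambda>t. \<bar>r t\<bar> powr (2 * \<alpha>)"] MVT2[of "1/2" 1 I "\<lambda>t. \<bar>r t\<bar> powr (2 * \<alpha>)"] dI by auto
    then have J: "J = (\<bar>r s\<bar> powr (2 * \<alpha>) + \<bar>r t\<bar> powr (2 * \<alpha>)) / 2"
      using I0 by (simp add: J_def)
    have "\<not> (r s = 0 \<and> r t = 0)"
    proof
      assume "r s = 0 \<and> r t = 0"
      then have z: "x\<^sub>0 + u\<^sub>0 * s = 0" "x\<^sub>0 + u\<^sub>0 * t = 0" by (auto simp: r_def)
      then have "u\<^sub>0 * (t - s) = 0" unfolding right_diff_distrib by linarith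
      then have "u\<^sub>0 = 0" using s t by simp
      with z ne show False by simp
    qed
    then have "\<bar>r s\<bar> powr (2 * \<alpha>) > 0 \<or> \<bar>r t\<bar> powr (2 * \<alpha>) > 0" by simp
    then show ?thesis unfolding J by (smt (verit) half_gt_zero_iff powr_ge_zero)
  qed
  \<comment> \<open>By energy conservation \<open>B\<close> bounds the velocity for all covectors
    with \<open>\<bar>u - u\<^sub>0\<bar> \<le> 1\<close> and \<open>\<bar>v\<bar> \<le> 1\<close>.
    Hence \<open>R\<close> bounds both \<open>x\<close> and \<open>r\<close> on the unit interval,
    \<open>C * v\<^sup>2\<close> bounds the force, and \<open>2 * C\<close> is a Lipschitz constant
    for \<open>\<bar>z\<bar> powr (2 * \<alpha>)\<close> there.\<close>
  define B where "B = sqrt ((\<bar>u\<^sub>0\<bar> + 1)\<^sup>2 + \<bar>x\<^sub>0\<bar> powr (2 * \<alpha>))"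
  define R where "R = \<bar>x\<^sub>0\<bar> + \<bar>u\<^sub>0\<bar> + B"
  have B: "B \<ge> 0" by (simp add: B_def)
  have R: "R \<ge> 0" using B by (simp add: R_def)
  define C where "C = \<alpha> * (R powr (2 * (\<alpha> - 1)) * R)"
  have C: "C \<ge> 0" using \<alpha> R by (simp add: C_def)
  have f_le: "\<bar>\<bar>z\<bar> powr (2 * (\<alpha> - 1)) * z\<bar> \<le> R powr (2 * (\<alpha> - 1)) * R" if "\<bar>z\<bar> \<le> R" for z :: real
    unfolding abs_mult using that \<alpha> R by (intro mult_mono) (auto intro!: powr_mono2)
  have powr_lip: "\<bar>\<bar>a\<bar> powr (2 * \<alpha>) - \<bar>b\<bar> powr (2 * \<alpha>)\<bar> \<le> 2 * C * \<bar>a - b\<bar>" if "\<bar>a\<bar> \<le> R" "\<bar>b\<bar> \<le> R" for a b :: real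
  proof -
    have "norm (\<bar>a\<bar> powr (2 * \<alpha>) - \<bar>b\<bar> powr (2 * \<alpha>)) \<le> 2 * C * norm (a - b)"
    proof (rule field_differentiable_bound[of "{- R..R}" "\<lambda>z. \<bar>z\<bar> powr (2 * \<alpha>)"
          "\<lambda>z. 2 * \<alpha> * (\<bar>z\<bar> powr (2 * \<alpha> - 2) * z)"])
      show "((\<lambda>z. \<bar>z\<bar> powr (2 * \<alpha>)) has_real_derivative 2 * \<alpha> * (\<bar>z\<bar> powr (2 * \<alpha> - 2) * z)) (at z within {- R..R})" for z
        by (rule has_field_derivative_at_within[OF has_real_derivative_abs_powr]) (use \<alpha> in simp)
      show "norm (2 * \<alpha> * (\<bar>z\<bar> powr (2 * \<alpha> - 2) * z)) \<le> 2 * C" if "z \<in> {- R..R}" for z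
      proof -
        have "\<bar>z\<bar> \<le> R" using that by auto
        from mult_left_mono[OF f_le[OF this], of "2 * \<alpha>"] \<alpha> show ?thesis
          by (simp add: C_def abs_mult right_diff_distrib)
      qed
    qed (use that in auto)
    then show ?thesis by simp
  qed
  \<comment> \<open>The constant in the final quadratic estimate:
    \<open>C * n\<^sup>2 + n * (2 * C * (n + C * n)) = M * n * n\<close>.\<close>
  define M where "M = C + 2 * C * (1 + C)"
  have M: "M \<ge> 0" using C by (simp add: M_def)
  have est: "\<bar>fst (grushin_exp \<alpha> (x\<^sub>0, y\<^sub>0) (u, v)) - (x\<^sub>0 + u)\<bar> \<le> C * v\<^sup>2 \<and>
     \<bar>snd (grushin_exp \<alpha> (x\<^sub>0, y\<^sub>0) (u, v)) - (y\<^sub>0 + J * v)\<bar> \<le> \<bar>v\<bar> * (2 * C * (\<bar>u - u\<^sub>0\<bar> + C * v\<^sup>2))"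
    if uv: "\<bar>u - u\<^sub>0\<bar> \<le> 1" "\<bar>v\<bar> \<le> 1" for u v
  proof -
    obtain x w y where i: "x 0 = x\<^sub>0" "w 0 = u" "y 0 = y\<^sub>0" and o: "oscillator \<alpha> v x w"
      and y: "\<And>t. (y has_real_derivative v * \<bar>x t\<bar> powr (2 * \<alpha>)) (at t)"
      and e: "grushin_exp \<alpha> (x\<^sub>0, y\<^sub>0) (u, v) = (x 1, y 1)"
      using grushin_exp_exists[OF \<alpha>, of x\<^sub>0 u y\<^sub>0 v] by metis
    have w: "\<bar>w t\<bar> \<le> B" for t
    proof -
      have v1: "v\<^sup>2 \<le> 1" using uv(2) by (simp add: abs_square_le_1)
      have "(w t)\<^sup>2 \<le> (w t)\<^sup>2 + v\<^sup>2 * \<bar>x t\<bar> powr (2 * \<alpha>)" by simp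
      also have "\<dots> = \<bar>u\<bar>\<^sup>2 + v\<^sup>2 * \<bar>x\<^sub>0\<bar> powr (2 * \<alpha>)" using oscillator_energy[OF \<alpha> o, of t] by (simp add: i)
      also have "\<dots> \<le> (\<bar>u\<^sub>0\<bar> + 1)\<^sup>2 + 1 * \<bar>x\<^sub>0\<bar> powr (2 * \<alpha>)"
        using uv v1 by (intro add_mono power_mono mult_right_mono) auto
      finally show ?thesis unfolding B_def using real_le_rsqrt[of "\<bar>w t\<bar>"] by simp
    qed
    have x: "\<bar>x t\<bar> \<le> R" if "0 \<le> t" "t \<le> 1" for t
      using abs_increment_le[OF oscillatorD(1)[OF o] w that] i by (simp add: R_def)
    have rR: "\<bar>r t\<bar> \<le> R" if "0 \<le> t" "t \<le> 1" for t
      using abs_increment_le[OF dr _ that, of "\<bar>u\<^sub>0\<bar>"] B by (simp add: R_def r_def)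
    have wu: "\<bar>w t - u\<bar> \<le> C * v\<^sup>2" if t: "0 \<le> t" "t \<le> 1" for t
    proof -
      have "\<bar>- (\<alpha> * v\<^sup>2 * (\<bar>x t\<bar> powr (2 * (\<alpha> - 1)) * x t))\<bar> \<le> C * v\<^sup>2" if "0 \<le> t" "t \<le> 1" for t
        using mult_left_mono[OF f_le[OF x[OF that]], of "\<alpha> * v\<^sup>2"] \<alpha>
        by (simp add: C_def abs_mult mult_ac)
      from abs_increment_le[OF oscillatorD(2)[OF o] this t] show ?thesis by (simp add: i)
    qed
    have xu: "\<bar>x t - (x\<^sub>0 + u * t)\<bar> \<le> C * v\<^sup>2" if t: "0 \<le> t" "t \<le> 1" for t
    proof -
      have "((\<lambda>t. x t - (x\<^sub>0 + u * t)) has_real_derivative w t - u) (at t)" for t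
        by (rule derivative_eq_intros oscillatorD(1)[OF o] refl | simp)+
      from abs_increment_le[OF this wu t] show ?thesis by (simp add: i)
    qed
    have xr: "\<bar>x t - r t\<bar> \<le> \<bar>u - u\<^sub>0\<bar> + C * v\<^sup>2" if t: "0 \<le> t" "t \<le> 1" for t
    proof -
      have "\<bar>(u - u\<^sub>0) * t\<bar> \<le> \<bar>u - u\<^sub>0\<bar>" using t by (simp add: abs_mult mult_left_le)
      moreover have "x t - r t = (x t - (x\<^sub>0 + u * t)) + (u - u\<^sub>0) * t" by (simp add: r_def algebra_simps)
      ultimately show ?thesis using xu[OF t] by linarith
    qed
    have "((\<lambda>t. y t - v * I t) has_real_derivative v * (\<bar>x t\<bar> powr (2 * \<alpha>) - \<bar>r t\<bar> powr (2 * \<alpha>))) (at t)" for t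
      by (rule derivative_eq_intros y dI refl | simp add: algebra_simps)+
    moreover have "\<bar>v * (\<bar>x t\<bar> powr (2 * \<alpha>) - \<bar>r t\<bar> powr (2 * \<alpha>))\<bar> \<le> \<bar>v\<bar> * (2 * C * (\<bar>u - u\<^sub>0\<bar> + C * v\<^sup>2))"
      if t: "0 \<le> t" "t \<le> 1" for t
    proof -
      have "\<bar>\<bar>x t\<bar> powr (2 * \<alpha>) - \<bar>r t\<bar> powr (2 * \<alpha>)\<bar> \<le> 2 * C * \<bar>x t - r t\<bar>" by (rule powr_lip[OF x[OF t] rR[OF t]])
      also have "\<dots> \<le> 2 * C * (\<bar>u - u\<^sub>0\<bar> + C * v\<^sup>2)" using xr[OF t] C by (intro mult_left_mono) auto
      finally show ?thesis unfolding abs_mult by (intro mult_left_mono) auto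
    qed
    ultimately have "\<bar>(y 1 - v * I 1) - (y 0 - v * I 0)\<bar> \<le> \<bar>v\<bar> * (2 * C * (\<bar>u - u\<^sub>0\<bar> + C * v\<^sup>2))"
      by (rule abs_increment_le) auto
    then show ?thesis using xu[of 1] by (simp add: e i I0 J_def algebra_simps)
  qed
  have base: "grushin_exp \<alpha> (x\<^sub>0, y\<^sub>0) (u\<^sub>0, 0) = (x\<^sub>0 + u\<^sub>0, y\<^sub>0)"
    using est[of u\<^sub>0 0] by (simp add: prod_eq_iff)
  have "(grushin_exp \<alpha> (x\<^sub>0, y\<^sub>0) has_derivative (\<lambda>h. (fst h, J * snd h))) (at (u\<^sub>0, 0) within UNIV)"
  proof (rule has_derivativeI_sandwich[where e = 1 and H = "\<lambda>l. M * norm (l - (u\<^sub>0, 0))"])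
    show "bounded_linear (\<lambda>h::real \<times> real. (fst h, J * snd h))" by (intro bounded_linear_intros)
    show "((\<lambda>l. M * norm (l - (u\<^sub>0, 0))) \<longlongrightarrow> 0) (at (u\<^sub>0, 0))"
      by (auto intro!: tendsto_eq_intros)
    fix l :: "real \<times> real"
    assume l: "l \<noteq> (u\<^sub>0, 0)" "dist l (u\<^sub>0, 0) < 1"
    define n where "n = norm (l - (u\<^sub>0, 0))"
    obtain u v where uv: "l = (u, v)" by (cases l)
    have n: "\<bar>u - u\<^sub>0\<bar> \<le> n" "\<bar>v\<bar> \<le> n" "n \<le> 1"
      using norm_fst_le[of "u - u\<^sub>0" v] norm_snd_le[of v "u - u\<^sub>0"] l
      by (auto simp: n_def uv dist_norm)
    have "n > 0" using l(1) by (simp add: n_def)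
    note n = n this
    have v2: "v\<^sup>2 \<le> n\<^sup>2" "v\<^sup>2 \<le> n"
    proof -
      show "v\<^sup>2 \<le> n\<^sup>2" using n(2) power_mono[of "\<bar>v\<bar>" n 2] by simp
      also have "n\<^sup>2 \<le> n" using n by (simp add: power2_eq_square mult_left_le)
      finally show "v\<^sup>2 \<le> n" .
    qed
    note e = est[of u v]
    have "norm (grushin_exp \<alpha> (x\<^sub>0, y\<^sub>0) l - grushin_exp \<alpha> (x\<^sub>0, y\<^sub>0) (u\<^sub>0, 0)
        - (fst (l - (u\<^sub>0, 0)), J * snd (l - (u\<^sub>0, 0))))
      = norm (fst (grushin_exp \<alpha> (x\<^sub>0, y\<^sub>0) (u, v)) - (x\<^sub>0 + u),
          snd (grushin_exp \<alpha> (x\<^sub>0, y\<^sub>0) (u, v)) - (y\<^sub>0 + J * v))"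
      by (intro arg_cong[where f = norm]) (simp add: base uv prod_eq_iff)
    also have "\<dots> \<le> \<bar>fst (grushin_exp \<alpha> (x\<^sub>0, y\<^sub>0) (u, v)) - (x\<^sub>0 + u)\<bar> +
        \<bar>snd (grushin_exp \<alpha> (x\<^sub>0, y\<^sub>0) (u, v)) - (y\<^sub>0 + J * v)\<bar>"
      using norm_Pair_le by (metis real_norm_def)
    also have "\<dots> \<le> C * v\<^sup>2 + \<bar>v\<bar> * (2 * C * (\<bar>u - u\<^sub>0\<bar> + C * v\<^sup>2))"
      using e n by (intro add_mono) auto
    also have "\<dots> \<le> C * n\<^sup>2 + n * (2 * C * (n + C * n))"
    proof (rule add_mono)
      show "C * v\<^sup>2 \<le> C * n\<^sup>2" using v2(1) C by (rule mult_left_mono)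
      have "\<bar>u - u\<^sub>0\<bar> + C * v\<^sup>2 \<le> n + C * n"
        using n(1) mult_left_mono[OF v2(2) C] by linarith
      then have "2 * C * (\<bar>u - u\<^sub>0\<bar> + C * v\<^sup>2) \<le> 2 * C * (n + C * n)"
        using C by (intro mult_left_mono) auto
      from mult_mono[OF n(2) this] show "\<bar>v\<bar> * (2 * C * (\<bar>u - u\<^sub>0\<bar> + C * v\<^sup>2)) \<le> n * (2 * C * (n + C * n))"
        using n(4) C by simp
    qed
    also have "\<dots> = M * n * n" by (simp add: M_def algebra_simps power2_eq_square)
    finally show "norm (grushin_exp \<alpha> (x\<^sub>0, y\<^sub>0) l - grushin_exp \<alpha> (x\<^sub>0, y\<^sub>0) (u\<^sub>0, 0)
        - (fst (l - (u\<^sub>0, 0)), J * snd (l - (u\<^sub>0, 0)))) / norm (l - (u\<^sub>0, 0)) \<le> M * norm (l - (u\<^sub>0, 0))"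
      unfolding n_def[symmetric] pos_divide_le_eq[OF \<open>n > 0\<close>] .
  qed simp
  with \<open>J > 0\<close> show ?thesis by (intro that[of J]) auto
qed

text \<open>Away from stationary extremals the differential at \<open>v = 0\<close> is diagonal with
  entries 1 and \<open>J > 0\<close>, hence injective.\<close>

lemma grushin_conj_horizontal:
  assumes \<alpha>: "\<alpha> \<ge> 1" and conj: "(u\<^sub>0, 0) \<in> grushin_conj \<alpha> (x\<^sub>0, y\<^sub>0)"
  shows "x\<^sub>0 = 0 \<and> u\<^sub>0 = 0"
proof (rule ccontr)
  assume "\<not> ?thesis"
  then have "x\<^sub>0 \<noteq> 0 \<or> u\<^sub>0 \<noteq> 0" by blast
  obtain J where J: "J > 0"
    and D: "(grushin_exp \<alpha> (x\<^sub>0, y\<^sub>0) has_derivative (\<lambda>h. (fst h, J * snd h))) (at (u\<^sub>0, 0))"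
    by (rule grushin_exp_derivative_horizontal[OF \<alpha> \<open>x\<^sub>0 \<noteq> 0 \<or> u\<^sub>0 \<noteq> 0\<close>])
  have "frechet_derivative (grushin_exp \<alpha> (x\<^sub>0, y\<^sub>0)) (at (u\<^sub>0, 0)) = (\<lambda>h. (fst h, J * snd h))"
    using frechet_derivative_at[OF D] by simp
  then show False using conj J by (auto simp: grushin_conj_def prod_eq_iff)
qed

section \<open>Conjugate covectors\<close>

text \<open>The differential maps the radial direction to the velocity of the endpoint.  At a conjugate
  covector the derivative along every other curve is parallel to it; the curves used here keep the
  end time fixed at \<open>1\<close>.\<close>

lemma grushin_conj_necessary:
  assumes \<alpha>: "\<alpha> \<ge> 1" and o: "oscillator \<alpha> v x u" and v: "v \<noteq> 0"
    and e: "e = (u 0)\<^sup>2 + v\<^sup>2 * \<bar>x 0\<bar> powr (2 * \<alpha>)" "e \<noteq> 0"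
    and conj: "(u 0, v) \<in> grushin_conj \<alpha> (x 0, y\<^sub>0)"
  shows "u 0 = 0 \<and> u 1 = 0 \<or> u 0 \<noteq> 0 \<and> u 1 \<noteq> 0 \<and> 1 - x 1 / u 1 = 0 - x 0 / u 0"
proof -
  define G where "G = grushin_exp \<alpha> (x 0, y\<^sub>0)"
  define E where "E = frechet_derivative G (at (u 0, v))"
  define K where "K t = e * t - x t * u t" for t
  have dK: "(K has_real_derivative (1 + \<alpha>) * v\<^sup>2 * \<bar>x t\<bar> powr (2 * \<alpha>)) (at t)" for t
    unfolding K_def by (rule oscillator_moment_derivative[OF \<alpha> o e(1)])
  note dx = oscillatorD(1)[OF o] and du = oscillatorD(2)[OF o]
  have diff: "G differentiable (at (u 0, v))"
    unfolding G_def using grushin_exp_differentiable[OF \<alpha> o v] e by simp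
  have lin: "linear E" unfolding E_def by (rule linear_frechet_derivative[OF diff])
  have fam: "G (a * w * u s, v * w * a powr (1 - \<alpha>)) =
      (a * x (s + w), y\<^sub>0 + a powr (1 + \<alpha>) / ((1 + \<alpha>) * v) * (K (s + w) - K s))"
    if "a > 0" "a * x s = x 0" for a w s
    using grushin_exp_family[OF \<alpha> o v that(1) e(1), of K s y\<^sub>0 w] that(2) by (simp add: G_def K_def)
  have ray: "E (u 0, v) = (u 1, v * \<bar>x 1\<bar> powr (2 * \<alpha>))"
  proof -
    define c where "c w = (w * u 0, v * w)" for w
    have c1: "c 1 = (u 0, v)" by (simp add: c_def)
    have "frechet_derivative G (at (c 1)) (u 0, v) = (u 1, v * \<bar>x 1\<bar> powr (2 * \<alpha>))"
    proof (rule frechet_derivative_along_curve[where P = x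
          and Q = "\<lambda>w. y\<^sub>0 + 1 / ((1 + \<alpha>) * v) * (K w - K 0)"])
      show "G differentiable (at (c 1))" using diff by (simp add: c1)
      show "(c has_vector_derivative (u 0, v)) (at 1)"
        unfolding c_def
        by (intro has_vector_derivative_Pair)
          (auto simp flip: has_real_derivative_iff_has_vector_derivative intro!: derivative_eq_intros)
      show "\<forall>\<^sub>F w in nhds 1. G (c w) = (x w, y\<^sub>0 + 1 / ((1 + \<alpha>) * v) * (K w - K 0))"
        using fam[of 1 0] by (intro always_eventually) (simp add: c_def)
      show "(x has_real_derivative u 1) (at 1)" by (rule dx)
      show "((\<lambda>w. y\<^sub>0 + 1 / ((1 + \<alpha>) * v) * (K w - K 0)) has_real_derivative v * \<bar>x 1\<bar> powr (2 * \<alpha>)) (at 1)"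
        by (rule derivative_eq_intros dK refl)+ (use v \<alpha> in \<open>simp add: power2_eq_square\<close>)
    qed
    then show ?thesis by (simp add: E_def c1)
  qed
  have sing: "u 1 * q = v * \<bar>x 1\<bar> powr (2 * \<alpha>) * p" if "E w = (p, q)" for w p q
  proof (rule ccontr)
    assume "\<not> ?thesis"
    then have "{h. E h = 0} = {0}"
      using linear_kernel_trivial_if_independent[OF lin ray that] by simp
    then show False using conj by (simp add: grushin_conj_def E_def G_def)
  qed
  \<comment> \<open>The curve with dilation \<open>a\<close>, start time \<open>s\<close> and
    duration \<open>1 - s\<close> stays in the cotangent space at the base point and ends at time 1
    of the given solution. The identity states that the derivative of its endpoint is parallel to
    the velocity of the endpoint.\<close>
  have key: "u 1 * (a' * (K 1 - K 0) / v - v * \<bar>x 0\<bar> powr (2 * \<alpha>) * s') = v * \<bar>x 1\<bar> powr (2 * \<alpha>) * (a' * x 1)"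
    if a: "(a has_real_derivative a') (at t)" "a t = 1" and s: "(s has_real_derivative s') (at t)" "s t = 0"
      and ev: "\<forall>\<^sub>F r in nhds t. a r * x (s r) = x 0" for a s a' s' t
  proof -
    define c where "c r = (a r * (1 - s r) * u (s r), v * (1 - s r) * a r powr (1 - \<alpha>))" for r
    have ct: "c t = (u 0, v)" using a(2) s(2) by (simp add: c_def)
    have p: "((\<lambda>r. a r powr k) has_real_derivative k * a') (at t)" for k
    proof -
      have "((\<lambda>z. z powr k) has_real_derivative k) (at (a t))"
        using has_real_derivative_powr[of 1 k] a(2) by simp
      from DERIV_chain2[OF this a(1)] show ?thesis .
    qed
    have us: "((\<lambda>r. u (s r)) has_real_derivative - (\<alpha> * v\<^sup>2 * (\<bar>x (s t)\<bar> powr (2 * (\<alpha> - 1)) * x (s t))) * s') (at t)"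
      by (rule DERIV_chain2[OF du s(1)])
    have "\<exists>c1. ((\<lambda>r. a r * (1 - s r) * u (s r)) has_real_derivative c1) (at t)"
      by (intro exI) (rule derivative_intros a s us)+
    then obtain c1 where c1: "((\<lambda>r. a r * (1 - s r) * u (s r)) has_real_derivative c1) (at t)" by blast
    have "\<exists>c2. ((\<lambda>r. v * (1 - s r) * a r powr (1 - \<alpha>)) has_real_derivative c2) (at t)"
      by (intro exI) (rule derivative_intros a(1) s p)+
    then obtain c2 where c2: "((\<lambda>r. v * (1 - s r) * a r powr (1 - \<alpha>)) has_real_derivative c2) (at t)" by blast
    have "(c has_vector_derivative (c1, c2)) (at t)"
      unfolding c_def
      by (intro has_vector_derivative_Pair c1[unfolded has_real_derivative_iff_has_vector_derivative]
          c2[unfolded has_real_derivative_iff_has_vector_derivative])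
    moreover have "isCont a t" using a(1) by (rule DERIV_isCont)
    then have "(a \<longlongrightarrow> a t) (nhds t)" unfolding isCont_def tendsto_at_iff_tendsto_nhds .
    then have "\<forall>\<^sub>F r in nhds t. a r > 0" by (rule order_tendstoD) (simp add: a(2))
    then have "\<forall>\<^sub>F r in nhds t. G (c r) = (a r * x 1, y\<^sub>0 + a r powr (1 + \<alpha>) / ((1 + \<alpha>) * v) * (K 1 - K (s r)))"
      using ev
    proof eventually_elim
      case (elim r)
      from fam[OF elim, of "1 - s r"] show ?case by (simp add: c_def)
    qed
    moreover have "((\<lambda>r. a r * x 1) has_real_derivative a' * x 1) (at t)"
      by (rule DERIV_cmult_right[OF a(1)])
    moreover have "((\<lambda>r. y\<^sub>0 + a r powr (1 + \<alpha>) / ((1 + \<alpha>) * v) * (K 1 - K (s r))) has_real_derivative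
        a' * (K 1 - K 0) / v - v * \<bar>x 0\<bar> powr (2 * \<alpha>) * s') (at t)"
    proof -
      have 1: "(1 + \<alpha>) * v \<noteq> 0" using \<alpha> v by simp
      have "((\<lambda>r. y\<^sub>0 + a r powr (1 + \<alpha>) / ((1 + \<alpha>) * v) * (K 1 - K (s r))) has_real_derivative
          0 + ((1 + \<alpha>) * a' / ((1 + \<alpha>) * v) * (K 1 - K (s t)) +
          (0 - (1 + \<alpha>) * v\<^sup>2 * \<bar>x (s t)\<bar> powr (2 * \<alpha>) * s') * (a t powr (1 + \<alpha>) / ((1 + \<alpha>) * v)))) (at t)"
        by (intro DERIV_add DERIV_const DERIV_mult DERIV_cdivide p DERIV_diff DERIV_chain2[OF dK s(1)])
      moreover have "0 + ((1 + \<alpha>) * a' / ((1 + \<alpha>) * v) * (K 1 - K (s t)) +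
          (0 - (1 + \<alpha>) * v\<^sup>2 * \<bar>x (s t)\<bar> powr (2 * \<alpha>) * s') * (a t powr (1 + \<alpha>) / ((1 + \<alpha>) * v))) =
          a' * (K 1 - K 0) / v - v * \<bar>x 0\<bar> powr (2 * \<alpha>) * s'"
        using v 1 by (simp add: a(2) s(2) power2_eq_square)
      ultimately show ?thesis by simp
    qed
    ultimately have "frechet_derivative G (at (c t)) (c1, c2) =
        (a' * x 1, a' * (K 1 - K 0) / v - v * \<bar>x 0\<bar> powr (2 * \<alpha>) * s')"
      using diff by (intro frechet_derivative_along_curve) (auto simp: ct)
    then show ?thesis by (intro sing) (simp add: E_def ct)
  qed
  show ?thesis
  proof (cases "u 0 = 0")
    case True
    then have x0: "x 0 \<noteq> 0" using e by auto
    \<comment> \<open>At a turning point the curve is parametrised by the time shift itself. The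
      dilation \<open>x 0 / x t\<close> is then stationary because \<open>u 0 = 0\<close>, so in
      \<open>key\<close> only the term with \<open>s'\<close> survives.\<close>
    have "((\<lambda>t. x 0 / x t) has_real_derivative 0) (at 0)"
      by (rule derivative_eq_intros dx refl)+ (use x0 True in auto)
    moreover have "\<forall>\<^sub>F t in nhds 0. x 0 / x t * x t = x 0"
    proof -
      have "(x \<longlongrightarrow> x 0) (nhds 0)"
        using oscillatorD(3)[OF o, of 0] by (simp add: isCont_def tendsto_at_iff_tendsto_nhds)
      from tendsto_imp_eventually_ne[OF this x0] show ?thesis by eventually_elim simp
    qed
    ultimately have "u 1 * (v * \<bar>x 0\<bar> powr (2 * \<alpha>)) = 0"
      using key[of "\<lambda>t. x 0 / x t" 0 0 "\<lambda>t. t" 1] x0 by simp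
    then show ?thesis using True v x0 by simp
  next
    case False
    \<comment> \<open>Where the solution starts with nonzero velocity, the dilation is the parameter
      and the start time is recovered by the local inverse of \<open>x\<close>; its derivative at
      \<open>a = 1\<close> is \<open>- (x 0 / u 0)\<close>.\<close>
    have "continuous_on UNIV u" by (intro continuous_at_imp_continuous_on ballI oscillatorD(4)[OF o])
    then obtain S T g where ST: "open S" "0 \<in> S" "open T" "x 0 \<in> T"
      and gS: "\<And>t. t \<in> S \<Longrightarrow> x t \<in> T \<and> g (x t) = t \<and> u t \<noteq> 0"
      and gT: "\<And>z. z \<in> T \<Longrightarrow> g z \<in> S \<and> x (g z) = z \<and> (g has_real_derivative inverse (u (g z))) (at z)"
      using real_local_inverse[of x u 0] dx False by metis
    have g0: "g (x 0) = 0" using gS ST by blast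
    have d: "((\<lambda>a. x 0 / a) has_real_derivative - x 0) (at 1)"
      by (rule derivative_eq_intros refl)+ auto
    have "(g has_real_derivative inverse (u 0)) (at (x 0 / 1))" using gT[OF ST(4)] g0 by simp
    from DERIV_chain2[OF this d]
    have "((\<lambda>a. g (x 0 / a)) has_real_derivative - (x 0 / u 0)) (at 1)" by (simp add: field_simps)
    moreover have "\<forall>\<^sub>F a in nhds 1. a * x (g (x 0 / a)) = x 0"
    proof -
      have "isCont (\<lambda>a. x 0 / a) 1" using d by (rule DERIV_isCont)
      then have "((\<lambda>a. x 0 / a) \<longlongrightarrow> x 0) (nhds 1)"
        using tendsto_at_iff_tendsto_nhds[of "\<lambda>a. x 0 / a" 1] by (simp add: isCont_def)
      then have "\<forall>\<^sub>F a in nhds 1. x 0 / a \<in> T" using ST(3,4) by (rule topological_tendstoD)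
      moreover have "\<forall>\<^sub>F a in nhds (1::real). a \<noteq> 0"
        by (rule tendsto_imp_eventually_ne[OF filterlim_ident]) simp
      ultimately show ?thesis by eventually_elim (use gT in simp)
    qed
    ultimately have *: "u 1 * ((K 1 - K 0) / v + v * \<bar>x 0\<bar> powr (2 * \<alpha>) * (x 0 / u 0)) = v * \<bar>x 1\<bar> powr (2 * \<alpha>) * x 1"
      using key[of "\<lambda>a. a" 1 1 "\<lambda>a. g (x 0 / a)" "- (x 0 / u 0)"] g0 by simp
    have en: "v\<^sup>2 * \<bar>x 0\<bar> powr (2 * \<alpha>) = e - (u 0)\<^sup>2" "v\<^sup>2 * \<bar>x 1\<bar> powr (2 * \<alpha>) = e - (u 1)\<^sup>2"
      using oscillator_energy[OF \<alpha> o, of 1] e by auto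
    have "u 1 \<noteq> 0"
    proof
      assume u1: "u 1 = 0"
      then have "x 1 = 0" using * v by simp
      then show False using en(2) u1 e(2) by simp
    qed
    moreover have "1 - x 1 / u 1 = 0 - x 0 / u 0"
    proof -
      \<comment> \<open>Multiplication by \<open>v\<close> makes the energy identities
        \<open>en\<close> applicable. After inserting them the terms without \<open>e\<close>
        cancel, and dividing by \<open>e\<close> leaves the equality of slopes.\<close>
      have "v * (u 1 * ((K 1 - K 0) / v + v * \<bar>x 0\<bar> powr (2 * \<alpha>) * (x 0 / u 0))) = v * (v * \<bar>x 1\<bar> powr (2 * \<alpha>) * x 1)"
        by (simp only: *)
      then have "u 1 * (K 1 - K 0 + (v\<^sup>2 * \<bar>x 0\<bar> powr (2 * \<alpha>)) * (x 0 / u 0)) = (v\<^sup>2 * \<bar>x 1\<bar> powr (2 * \<alpha>)) * x 1"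
        using v by (simp add: distrib_left power2_eq_square mult_ac)
      then have "e * (u 1 * (1 + x 0 / u 0)) = e * x 1"
        using False unfolding en by (simp add: K_def field_simps power2_eq_square)
      then have "u 1 * (1 + x 0 / u 0) = x 1" using e(2) by simp
      then show ?thesis using \<open>u 1 \<noteq> 0\<close> by (simp add: field_simps)
    qed
    ultimately show ?thesis using False by blast
  qed
qed

section \<open>Failure of injectivity\<close>

lemma oscillator_sign_change:
  assumes "oscillator \<alpha> v x u" "\<bar>c\<bar> = 1"
  shows "oscillator \<alpha> v (\<lambda>t. c * x t) (\<lambda>t. c * u t)"
  unfolding oscillator_def
proof (intro conjI allI)
  fix t
  show "((\<lambda>t. c * x t) has_real_derivative c * u t) (at t)"
    by (rule DERIV_cmult[OF oscillatorD(1)[OF assms(1)]])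
  show "((\<lambda>t. c * u t) has_real_derivative
      - (\<alpha> * v\<^sup>2 * (\<bar>c * x t\<bar> powr (2 * (\<alpha> - 1)) * (c * x t)))) (at t)"
    by (rule DERIV_cong[OF DERIV_cmult[OF oscillatorD(2)[OF assms(1)]]]) (simp add: abs_mult assms(2))
qed

text \<open>By energy conservation \<open>x 1\<close> is \<open>x 0\<close> up to a sign
  \<open>c\<close>, and uniqueness makes \<open>x\<close> even and
  \<open>x (t + 1) = c * x t\<close>. The rescaled extremals started at \<open>t\<close> and at
  \<open>-t\<close> have the same dilation and the same endpoint, but opposite initial
  velocities.\<close>

lemma not_inj_if_turning_points:
  assumes \<alpha>: "\<alpha> \<ge> 1" and o: "oscillator \<alpha> v x u" and v: "v \<noteq> 0"
    and x0: "x 0 \<noteq> 0" and u: "u 0 = 0" "u 1 = 0" and U: "open U" "(u 0, v) \<in> U"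
  shows "\<not> inj_on (grushin_exp \<alpha> (x 0, y\<^sub>0)) U"
proof -
  define e where "e = (u 0)\<^sup>2 + v\<^sup>2 * \<bar>x 0\<bar> powr (2 * \<alpha>)"
  define K where "K t = e * t - x t * u t" for t
  define c where "c = x 1 / x 0"
  have "v\<^sup>2 * \<bar>x 1\<bar> powr (2 * \<alpha>) = v\<^sup>2 * \<bar>x 0\<bar> powr (2 * \<alpha>)"
    using oscillator_energy[OF \<alpha> o, of 1] u by simp
  then have "(\<bar>x 1\<bar> powr (2 * \<alpha>)) powr (1 / (2 * \<alpha>)) = (\<bar>x 0\<bar> powr (2 * \<alpha>)) powr (1 / (2 * \<alpha>))"
    using v by simp
  then have "\<bar>x 1\<bar> = \<bar>x 0\<bar>" using \<alpha> by (simp add: powr_powr)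
  then have "x 1 = x 0 \<or> x 1 = - x 0" by linarith
  then have c: "\<bar>c\<bar> = 1" "c * c = 1" using x0 by (auto simp: c_def)
  have even: "x (- t) = x t" "u (- t) = - u t" for t
    using oscillator_unique[OF \<alpha> oscillator_reflect[OF o] o, of t] u by auto
  have shift: "x (t + 1) = c * x t" "u (t + 1) = c * u t" for t
  proof -
    have "oscillator \<alpha> v (\<lambda>t. x (t + 1)) (\<lambda>t. u (t + 1))"
      using oscillator_scale_shift[OF o, of 1 1 1] by (simp add: add.commute)
    from oscillator_unique[OF \<alpha> this oscillator_sign_change[OF o c(1)], of t]
    show "x (t + 1) = c * x t" "u (t + 1) = c * u t" using u x0 by (simp_all add: c_def)
  qed
  define a where "a t = x 0 / x t" for t
  define L where "L t = (a t * u t, v * a t powr (1 - \<alpha>))" for t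
  have ex: "grushin_exp \<alpha> (x 0, y\<^sub>0) (L t) = (c * x 0, y\<^sub>0 + a t powr (1 + \<alpha>) / ((1 + \<alpha>) * v) * e)"
    if "a t > 0" for t
  proof -
    have "x t \<noteq> 0" using that by (auto simp: a_def)
    then have ax: "a t * x t = x 0" by (simp add: a_def)
    \<comment> \<open>Since \<open>c * c = 1\<close>, the increment of \<open>K\<close> over unit
      time does not depend on \<open>t\<close>. The endpoint thus depends only on the dilation,
      which is even in \<open>t\<close>.\<close>
    have "K (t + 1) - K t = e - (c * c) * (x t * u t) + x t * u t"
      unfolding K_def shift by (simp add: algebra_simps)
    then have KK: "K (t + 1) - K t = e" by (simp add: c(2))
    have "a t * x (t + 1) = c * (a t * x t)" by (simp add: shift)
    then have "a t * x (t + 1) = c * x 0" by (simp add: ax)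
    with grushin_exp_family[OF \<alpha> o v that e_def K_def, of t y\<^sub>0 1] show ?thesis
      by (simp add: ax KK L_def)
  qed
  have cx: "(x \<longlongrightarrow> x 0) (at 0)" and cu: "(u \<longlongrightarrow> u 0) (at 0)"
    using oscillatorD(3,4)[OF o, of 0] by (auto simp: isCont_def)
  have ca: "(a \<longlongrightarrow> 1) (at 0)" unfolding a_def using cx x0 by (auto intro!: tendsto_eq_intros)
  have cL: "(L \<longlongrightarrow> (u 0, v)) (at 0)" unfolding L_def by (auto intro!: tendsto_eq_intros ca cu)
  have "\<forall>\<^sub>F t in at 0. L t \<in> U" by (rule topological_tendstoD[OF cL U])
  moreover have "\<forall>\<^sub>F t in at 0. L (- t) \<in> U"
  proof -
    have "(\<lambda>t. L (- t)) = (\<lambda>t. (a t * - u t, v * a t powr (1 - \<alpha>)))"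
      by (simp add: L_def a_def even)
    then have "((\<lambda>t. L (- t)) \<longlongrightarrow> (u 0, v)) (at 0)"
      by (auto simp: u intro!: tendsto_eq_intros ca cu)
    then show ?thesis by (rule topological_tendstoD[OF _ U])
  qed
  moreover have "\<forall>\<^sub>F t in at 0. a t > 0" using ca by (rule order_tendstoD) simp
  \<comment> \<open>The acceleration at 0 is nonzero as \<open>x 0 \<noteq> 0\<close>; this is what
    makes the two covectors distinct.\<close>
  moreover have "\<forall>\<^sub>F t in at 0. u t \<noteq> 0"
  proof -
    have "((\<lambda>t. u t / t) \<longlongrightarrow> - (\<alpha> * v\<^sup>2 * (\<bar>x 0\<bar> powr (2 * (\<alpha> - 1)) * x 0))) (at 0)"
      using oscillatorD(2)[OF o, of 0] u by (simp add: DERIV_def)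
    then have "\<forall>\<^sub>F t in at 0. u t / t \<noteq> 0"
      by (rule tendsto_imp_eventually_ne) (use \<alpha> v x0 in simp)
    then show ?thesis by eventually_elim auto
  qed
  ultimately have "\<forall>\<^sub>F t::real in at 0. L t \<in> U \<and> L (- t) \<in> U \<and> a t > 0 \<and> u t \<noteq> 0"
    by eventually_elim auto
  then obtain t where t: "L t \<in> U" "L (- t) \<in> U" "a t > 0" "u t \<noteq> 0"
    using eventually_happens'[OF at_neq_bot] by blast
  have am: "a (- t) = a t" by (simp add: a_def even)
  have "grushin_exp \<alpha> (x 0, y\<^sub>0) (L t) = grushin_exp \<alpha> (x 0, y\<^sub>0) (L (- t))"
    using ex[of t] ex[of "- t"] t am by simp
  moreover have "L t \<noteq> L (- t)" using t am by (simp add: L_def even)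
  ultimately show ?thesis using t by (auto simp: inj_on_def)
qed

section \<open>Extremals with equal slopes at the two ends\<close>

lemma family_covector_eq_imp_dilation_eq:
  assumes \<alpha>: "\<alpha> \<ge> 1" and o: "oscillator \<alpha> v x u" and v: "v \<noteq> 0"
    and e: "(u 0)\<^sup>2 + v\<^sup>2 * \<bar>x 0\<bar> powr (2 * \<alpha>) \<noteq> 0"
    and pos: "a > 0" "a' > 0" "w > 0" "w' > 0" and base: "a * x s = a' * x s'"
    and eq: "a * w * u s = a' * w' * u s'" "v * w * a powr (1 - \<alpha>) = v * w' * a' powr (1 - \<alpha>)"
  shows "a = a'"
proof -
  define e where "e = (u 0)\<^sup>2 + v\<^sup>2 * \<bar>x 0\<bar> powr (2 * \<alpha>)"
  \<comment> \<open>Twice the Hamiltonian of a rescaled covector is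
    \<open>(a * w)\<^sup>2 * e\<close>, so equal covectors at the same base point have equal
    products \<open>a * w\<close>. The second component is
    \<open>v * (a * w) * a powr (- \<alpha>)\<close> and then determines \<open>a\<close>.\<close>
  have en: "(a * w * u s)\<^sup>2 + (v * w * a powr (1 - \<alpha>))\<^sup>2 * \<bar>a * x s\<bar> powr (2 * \<alpha>) = (a * w)\<^sup>2 * e"
    if "a > 0" for a w s
  proof -
    have "(a powr (1 - \<alpha>))\<^sup>2 * a powr (2 * \<alpha>) = a\<^sup>2"
      using that by (simp add: powr_power flip: powr_add)
    then have "(v * w * a powr (1 - \<alpha>))\<^sup>2 * \<bar>a * x s\<bar> powr (2 * \<alpha>) = a\<^sup>2 * w\<^sup>2 * (v\<^sup>2 * \<bar>x s\<bar> powr (2 * \<alpha>))"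
      using that by (simp add: abs_mult powr_mult power_mult_distrib)
    then have "(a * w * u s)\<^sup>2 + (v * w * a powr (1 - \<alpha>))\<^sup>2 * \<bar>a * x s\<bar> powr (2 * \<alpha>) =
        a\<^sup>2 * w\<^sup>2 * ((u s)\<^sup>2 + v\<^sup>2 * \<bar>x s\<bar> powr (2 * \<alpha>))"
      unfolding distrib_left by (simp only: power_mult_distrib)
    then show ?thesis
      unfolding oscillator_energy[OF \<alpha> o, of s] e_def[symmetric] by (simp only: power_mult_distrib)
  qed
  have "(a * w)\<^sup>2 * e = (a' * w')\<^sup>2 * e"
    using en[OF pos(1), of w s] en[OF pos(2), of w' s'] unfolding base eq by linarith
  then have "(a * w)\<^sup>2 = (a' * w')\<^sup>2" using e by (simp add: e_def)
  then have aw: "a * w = a' * w'" using pos by (simp add: power2_eq_iff_nonneg)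
  have split: "v * w * a powr (1 - \<alpha>) = v * (a * w) * a powr (- \<alpha>)" if "a > 0" for a w
    using that powr_add[of a 1 "- \<alpha>"] by simp
  have "a powr (- \<alpha>) = a' powr (- \<alpha>)"
    using eq(2) unfolding split[OF pos(1)] split[OF pos(2)] aw using v pos by simp
  then have "(a powr (- \<alpha>)) powr (- 1 / \<alpha>) = (a' powr (- \<alpha>)) powr (- 1 / \<alpha>)" by simp
  then show "a = a'" using \<alpha> pos by (simp add: powr_powr)
qed

text \<open>The strict sign is lost only at zeros of \<open>x\<close>, and \<open>x\<close> has at most one zero while \<open>u \<noteq> 0\<close>.\<close>

lemma oscillator_slope_strict_decreasing:
  assumes \<alpha>: "\<alpha> \<ge> 1" and o: "oscillator \<alpha> v x u" and v: "v \<noteq> 0" and "s < t"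
    and u: "\<And>r. s \<le> r \<Longrightarrow> r \<le> t \<Longrightarrow> u r \<noteq> 0"
  shows "t - x t / u t < s - x s / u s"
proof -
  define h where "h r = r - x r / u r" for r
  \<comment> \<open>The derivative of \<open>h\<close>: the quotient rule gives 1 plus a nonnegative
    term for \<open>x / u\<close>, and the ones cancel.\<close>
  define h' where "h' r = - (\<alpha> * v\<^sup>2 * \<bar>x r\<bar> powr (2 * \<alpha>) / (u r)\<^sup>2)" for r
  have dh: "(h has_real_derivative h' r) (at r)" if "s \<le> r" "r \<le> t" for r
  proof -
    have "(h has_real_derivative
        1 - (u r * u r - x r * - (\<alpha> * v\<^sup>2 * (\<bar>x r\<bar> powr (2 * (\<alpha> - 1)) * x r))) / (u r * u r)) (at r)"
      unfolding h_def
      by (rule derivative_eq_intros oscillatorD(1,2)[OF o] refl u[OF that] | simp)+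
    moreover have "x r * - (\<alpha> * v\<^sup>2 * (\<bar>x r\<bar> powr (2 * (\<alpha> - 1)) * x r)) = - (\<alpha> * v\<^sup>2 * \<bar>x r\<bar> powr (2 * \<alpha>))"
      using abs_powr_twice_split[of "x r" \<alpha>] by (simp add: mult_ac)
    then have "1 - (u r * u r - x r * - (\<alpha> * v\<^sup>2 * (\<bar>x r\<bar> powr (2 * (\<alpha> - 1)) * x r))) / (u r * u r) = h' r"
      using u[OF that] by (simp add: h'_def add_divide_distrib power2_eq_square)
    ultimately show ?thesis by simp
  qed
  \<comment> \<open>Mean values on both halves give points \<open>p < q\<close>; two zeros of
    \<open>x\<close> there would force a zero of \<open>u\<close> in between.\<close>
  define m where "m = (s + t) / 2"
  have m: "s < m" "m < t" using \<open>s < t\<close> by (auto simp: m_def)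
  obtain p where p: "s < p" "p < m" "h m - h s = (m - s) * h' p"
    using MVT2[OF m(1), of h h'] dh m by auto
  obtain q where q: "m < q" "q < t" "h t - h m = (t - m) * h' q"
    using MVT2[OF m(2), of h h'] dh m by auto
  have neg: "h' r < 0" if "x r \<noteq> 0" "u r \<noteq> 0" for r
    using that \<alpha> v by (auto simp: h'_def intro!: divide_pos_pos mult_pos_pos)
  have le: "h' r \<le> 0" for r using \<alpha> by (simp add: h'_def)
  have "\<not> (x p = 0 \<and> x q = 0)"
  proof
    assume z: "x p = 0 \<and> x q = 0"
    obtain r where "p < r" "r < q" "x q - x p = (q - p) * u r"
      using MVT2[of p q x u] oscillatorD(1)[OF o] p q by auto
    then show False using z u[of r] p q by simp
  qed
  then have "h' p < 0 \<or> h' q < 0" using neg u p q m by (metis less_imp_le less_trans)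
  then have "(m - s) * h' p + (t - m) * h' q < 0"
    using le[of p] le[of q] m by (smt (verit) mult_pos_neg mult_nonneg_nonpos)
  then have "h t < h s" using p q by linarith
  then show ?thesis by (simp add: h_def)
qed

text \<open>On a level the first coordinate is fixed and \<open>L\<close> separates dilations, so
  injectivity of the exponential map would make \<open>F\<close> injective in \<open>a\<close> near
  1. Its derivative at \<open>a = 1\<close> is a positive multiple of the slope at
  \<open>\<tau>\<close> minus the slope at 1, since the slopes at 0 and 1 agree, and this changes
  sign at \<open>\<tau> = 1\<close>.\<close>

lemma not_inj_if_equal_slopes:
  assumes \<alpha>: "\<alpha> \<ge> 1" and o: "oscillator \<alpha> v x u" and v: "v \<noteq> 0"
    and u: "u 0 \<noteq> 0" "u 1 \<noteq> 0" and slope: "1 - x 1 / u 1 = 0 - x 0 / u 0"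
    and U: "open U" "(u 0, v) \<in> U"
  shows "\<not> inj_on (grushin_exp \<alpha> (x 0, y\<^sub>0)) U"
proof
  assume inj: "inj_on (grushin_exp \<alpha> (x 0, y\<^sub>0)) U"
  define e where "e = (u 0)\<^sup>2 + v\<^sup>2 * \<bar>x 0\<bar> powr (2 * \<alpha>)"
  define K where "K t = e * t - x t * u t" for t
  have e: "e > 0" using u by (simp add: e_def add_pos_nonneg)
  note dx = oscillatorD(1)[OF o] and cx = oscillatorD(3)[OF o] and cu = oscillatorD(4)[OF o]
  have dK: "(K has_real_derivative (1 + \<alpha>) * v\<^sup>2 * \<bar>x t\<bar> powr (2 * \<alpha>)) (at t)" for t
    unfolding K_def by (rule oscillator_moment_derivative[OF \<alpha> o e_def])
  have cK: "isCont K t" for t using dK by (rule DERIV_isCont)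
  have contu: "continuous_on UNIV u" by (intro continuous_at_imp_continuous_on ballI cu)
  obtain S0 T0 g0 where ST0: "open S0" "0 \<in> S0" "open T0" "x 0 \<in> T0"
    and gS0: "\<And>t. t \<in> S0 \<Longrightarrow> x t \<in> T0 \<and> g0 (x t) = t \<and> u t \<noteq> 0"
    and gT0: "\<And>z. z \<in> T0 \<Longrightarrow> g0 z \<in> S0 \<and> x (g0 z) = z \<and> (g0 has_real_derivative inverse (u (g0 z))) (at z)"
    by (rule real_local_inverse[OF dx contu u(1)]) blast
  obtain S1 T1 g1 where ST1: "open S1" "1 \<in> S1" "open T1" "x 1 \<in> T1"
    and gS1: "\<And>t. t \<in> S1 \<Longrightarrow> x t \<in> T1 \<and> g1 (x t) = t \<and> u t \<noteq> 0"
    and gT1: "\<And>z. z \<in> T1 \<Longrightarrow> g1 z \<in> S1 \<and> x (g1 z) = z \<and> (g1 has_real_derivative inverse (u (g1 z))) (at z)"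
    by (rule real_local_inverse[OF dx contu u(2)]) blast
  have c0: "isCont g0 z" if "z \<in> T0" for z using gT0[OF that] DERIV_isCont by blast
  have c1: "isCont g1 z" if "z \<in> T1" for z using gT1[OF that] DERIV_isCont by blast
  have g00: "g0 (x 0) = 0" and g11: "g1 (x 1) = 1" using gS0 gS1 ST0 ST1 by auto
  text \<open>The level set on which the first coordinate of the endpoint equals \<open>x \<tau>\<close> is parametrised
    by the dilation \<open>a\<close>; start and end times are \<open>\<phi> a\<close> and \<open>\<theta> a \<tau>\<close>.\<close>
  define \<phi> where "\<phi> a = g0 (x 0 / a)" for a
  define \<theta> where "\<theta> a \<tau> = g1 (x \<tau> / a)" for a \<tau>
  define L where "L a \<tau> = (a * (\<theta> a \<tau> - \<phi> a) * u (\<phi> a), v * (\<theta> a \<tau> - \<phi> a) * a powr (1 - \<alpha>))" for a \<tau>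
  define F where "F a \<tau> = a powr (1 + \<alpha>) * (K (\<theta> a \<tau>) - K (\<phi> a))" for a \<tau>
  \<comment> \<open>All conditions on dilation and level under which the parametrisation is valid:
    the local inverses apply, the duration is positive and the covector lies in \<open>U\<close>.
    They are open conditions that hold at \<open>(1, 1)\<close>.\<close>
  define good where "good p \<longleftrightarrow> fst p > 0 \<and> x 0 / fst p \<in> T0 \<and> snd p \<in> S1 \<and> x (snd p) / fst p \<in> T1 \<and>
    \<theta> (fst p) (snd p) - \<phi> (fst p) > 0 \<and> L (fst p) (snd p) \<in> U" for p :: "real \<times> real"
  have "\<forall>\<^sub>F p in nhds (1, 1). good p"
  proof -
    have "((\<lambda>p. p) \<longlongrightarrow> (1, 1)) (nhds (1::real, 1::real))" by (rule filterlim_ident)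
    from tendsto_fst[OF this] tendsto_snd[OF this]
    have a: "((\<lambda>p. fst p) \<longlongrightarrow> 1) (nhds (1::real, 1::real))" and \<tau>: "((\<lambda>p. snd p) \<longlongrightarrow> 1) (nhds (1::real, 1::real))"
      by simp_all
    have x0a: "((\<lambda>p. x 0 / fst p) \<longlongrightarrow> x 0) (nhds (1::real, 1::real))"
      using tendsto_divide[OF tendsto_const a] by simp
    have xa: "((\<lambda>p. x (snd p) / fst p) \<longlongrightarrow> x 1) (nhds (1::real, 1::real))"
      using tendsto_divide[OF isCont_tendsto_compose[OF cx \<tau>] a] by simp
    have ph: "((\<lambda>p. \<phi> (fst p)) \<longlongrightarrow> 0) (nhds (1::real, 1::real))"
      using isCont_tendsto_compose[OF c0[OF ST0(4)] x0a] by (simp add: \<phi>_def g00)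
    have th: "((\<lambda>p. \<theta> (fst p) (snd p)) \<longlongrightarrow> 1) (nhds (1::real, 1::real))"
      using isCont_tendsto_compose[OF c1[OF ST1(4)] xa] by (simp add: \<theta>_def g11)
    have w: "((\<lambda>p. \<theta> (fst p) (snd p) - \<phi> (fst p)) \<longlongrightarrow> 1) (nhds (1::real, 1::real))"
      using tendsto_diff[OF th ph] by simp
    have pw: "((\<lambda>p. fst p powr (1 - \<alpha>)) \<longlongrightarrow> 1) (nhds (1::real, 1::real))"
      using tendsto_powr[OF a tendsto_const, of "1 - \<alpha>"] by simp
    have "((\<lambda>p. fst p * (\<theta> (fst p) (snd p) - \<phi> (fst p)) * u (\<phi> (fst p))) \<longlongrightarrow> u 0) (nhds (1::real, 1::real))"
      using tendsto_mult[OF tendsto_mult[OF a w] isCont_tendsto_compose[OF cu ph]] by simp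
    moreover have "((\<lambda>p. v * (\<theta> (fst p) (snd p) - \<phi> (fst p)) * fst p powr (1 - \<alpha>)) \<longlongrightarrow> v) (nhds (1::real, 1::real))"
      using tendsto_mult[OF tendsto_mult[OF tendsto_const w] pw] by simp
    ultimately have LU: "((\<lambda>p. L (fst p) (snd p)) \<longlongrightarrow> (u 0, v)) (nhds (1::real, 1::real))"
      unfolding L_def by (rule tendsto_Pair)
    from order_tendstoD(1)[OF a, of 0] topological_tendstoD[OF x0a ST0(3,4)] topological_tendstoD[OF \<tau> ST1(1,2)]
      topological_tendstoD[OF xa ST1(3,4)] order_tendstoD(1)[OF w, of 0] topological_tendstoD[OF LU U]
    show ?thesis unfolding good_def by (simp add: eventually_conj_iff)
  qed
  then obtain d where d: "d > 0" "\<And>p. dist p (1, 1) < d \<Longrightarrow> good p"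
    unfolding eventually_nhds_metric by blast
  \<comment> \<open>Half the radius: the distance to \<open>(1, 1)\<close> is at most the sum of the
    two coordinate distances, which is below \<open>2 * \<delta>\<close>.\<close>
  define \<delta> where "\<delta> = d / 2"
  have "\<delta> > 0" using d by (simp add: \<delta>_def)
  have good: "good (a, \<tau>)" if "a \<in> {1 - \<delta>..1 + \<delta>}" "\<bar>\<tau> - 1\<bar> < \<delta>" for a \<tau>
  proof (rule d(2))
    have "dist (a, \<tau>) (1, 1) \<le> \<bar>a - 1\<bar> + \<bar>\<tau> - 1\<bar>"
      using norm_Pair_le[of "a - 1" "\<tau> - 1"] by (simp add: dist_norm)
    moreover have "\<bar>a - 1\<bar> \<le> \<delta>" using that(1) by (simp add: abs_le_iff)
    ultimately show "dist (a, \<tau>) (1, 1) < d" using that(2) by (simp add: \<delta>_def)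
  qed
  have th1: "\<theta> 1 \<tau> = \<tau>" "u \<tau> \<noteq> 0" if "\<bar>\<tau> - 1\<bar> < \<delta>" for \<tau>
    using good[of 1 \<tau>] that \<open>\<delta> > 0\<close> gS1 by (auto simp: good_def \<theta>_def)
  define D where "D \<tau> = (1 + \<alpha>) * e * ((\<tau> - x \<tau> / u \<tau>) - (1 - x 1 / u 1))" for \<tau>
  have "\<exists>\<tau>. \<bar>\<tau> - 1\<bar> < \<delta> \<and> \<not> inj_on (\<lambda>a. F a \<tau>) {1 - \<delta>..1 + \<delta>}"
  proof (rule not_inj_on_level_if_derivative_changes_sign[where d = D])
    show "continuous_on {1 - \<delta>..1 + \<delta>} (\<lambda>a. F a \<tau>)" if \<tau>: "\<bar>\<tau> - 1\<bar> < \<delta>" for \<tau>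
    proof (intro continuous_at_imp_continuous_on ballI)
      fix a assume "a \<in> {1 - \<delta>..1 + \<delta>}"
      from good[OF this \<tau>] have g: "a > 0" "x 0 / a \<in> T0" "x \<tau> / a \<in> T1" by (auto simp: good_def)
      have k: "isCont (\<lambda>a. k / a) a" for k using g by (intro continuous_intros) auto
      from isCont_o2[where g = g0, OF k c0[OF g(2)]] have "isCont (\<lambda>a. K (g0 (x 0 / a))) a"
        by (rule isCont_o2[OF _ cK])
      moreover from isCont_o2[where g = g1, OF k c1[OF g(3)]] have "isCont (\<lambda>a. K (g1 (x \<tau> / a))) a"
        by (rule isCont_o2[OF _ cK])
      ultimately show "isCont (\<lambda>a. F a \<tau>) a"
        unfolding F_def \<phi>_def \<theta>_def using g by (intro continuous_intros) auto
    qed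
    show "isCont (F a) 1" if "a \<in> {1 - \<delta>, 1 + \<delta>}" for a
    proof -
      have "good (a, 1)" using that \<open>\<delta> > 0\<close> by (intro good) auto
      then have g: "a > 0" "x 1 / a \<in> T1" by (auto simp: good_def)
      have "isCont (\<lambda>\<tau>. x \<tau> / a) 1" using g by (intro continuous_intros cx) auto
      from isCont_o2[where f = "\<lambda>\<tau>. x \<tau> / a" and g = g1, OF this c1[OF g(2)]]
      have "isCont (\<lambda>\<tau>. K (g1 (x \<tau> / a))) 1" by (rule isCont_o2[OF _ cK])
      then have "isCont (\<lambda>\<tau>. a powr (1 + \<alpha>) * (K (g1 (x \<tau> / a)) - K (\<phi> a))) 1" by (intro continuous_intros)
      then show ?thesis by (simp add: F_def[abs_def] \<theta>_def)
    qed
    show "((\<lambda>a. F a \<tau>) has_real_derivative D \<tau>) (at 1)" if \<tau>: "\<bar>\<tau> - 1\<bar> < \<delta>" for \<tau>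
    proof -
      have "good (1, \<tau>)" using that \<open>\<delta> > 0\<close> by (intro good) auto
      then have T: "x \<tau> / 1 \<in> T1" by (auto simp: good_def)
      have T': "x 0 / 1 \<in> T0" using ST0 by simp
      have id: "((\<lambda>a. k / a) has_real_derivative - k) (at 1)" for k :: real
        by (rule derivative_eq_intros refl)+ auto
      have 1: "((\<lambda>a. K (\<theta> a \<tau>)) has_real_derivative
          (1 + \<alpha>) * v\<^sup>2 * \<bar>x (\<theta> 1 \<tau>)\<bar> powr (2 * \<alpha>) * (inverse (u (\<theta> 1 \<tau>)) * - x \<tau>)) (at 1)"
        unfolding \<theta>_def by (rule DERIV_chain2[OF dK DERIV_chain2[OF _ id]]) (use gT1[OF T] in blast)
      have 2: "((\<lambda>a. K (\<phi> a)) has_real_derivative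
          (1 + \<alpha>) * v\<^sup>2 * \<bar>x (\<phi> 1)\<bar> powr (2 * \<alpha>) * (inverse (u (\<phi> 1)) * - x 0)) (at 1)"
        unfolding \<phi>_def by (rule DERIV_chain2[OF dK DERIV_chain2[OF _ id]]) (use gT0[OF T'] in blast)
      have p: "((\<lambda>a. a powr (1 + \<alpha>)) has_real_derivative 1 + \<alpha>) (at 1)"
        using has_real_derivative_powr[of 1 "1 + \<alpha>"] by simp
      have ph1: "\<phi> 1 = 0" by (simp add: \<phi>_def g00)
      note th = th1[OF \<tau>]
      \<comment> \<open>Energy conservation converts each end's contribution to the derivative of
        \<open>F\<close> into \<open>e\<close> times the slope.\<close>
      have slope_eq: "K t - (v\<^sup>2 * \<bar>x t\<bar> powr (2 * \<alpha>)) * (x t / u t) = e * (t - x t / u t)" if "u t \<noteq> 0" for t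
      proof -
        have v2: "v\<^sup>2 * \<bar>x t\<bar> powr (2 * \<alpha>) = e - (u t)\<^sup>2"
          using oscillator_energy[OF \<alpha> o, of t] by (simp add: e_def)
        show ?thesis unfolding v2 using that by (simp add: K_def field_simps power2_eq_square)
      qed
      have "(1 + \<alpha>) * (K \<tau> - K 0) +
          ((1 + \<alpha>) * v\<^sup>2 * \<bar>x \<tau>\<bar> powr (2 * \<alpha>) * (inverse (u \<tau>) * - x \<tau>) -
           (1 + \<alpha>) * v\<^sup>2 * \<bar>x 0\<bar> powr (2 * \<alpha>) * (inverse (u 0) * - x 0)) * 1 powr (1 + \<alpha>) =
          (1 + \<alpha>) * ((K \<tau> - (v\<^sup>2 * \<bar>x \<tau>\<bar> powr (2 * \<alpha>)) * (x \<tau> / u \<tau>)) -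
            (K 0 - (v\<^sup>2 * \<bar>x 0\<bar> powr (2 * \<alpha>)) * (x 0 / u 0)))"
        by (simp add: divide_inverse algebra_simps)
      also have "\<dots> = D \<tau>"
        unfolding slope_eq[OF th(2)] slope_eq[OF u(1)] D_def slope
        by (simp only: right_diff_distrib mult.assoc)
      finally have eq: "(1 + \<alpha>) * (K \<tau> - K 0) +
          ((1 + \<alpha>) * v\<^sup>2 * \<bar>x \<tau>\<bar> powr (2 * \<alpha>) * (inverse (u \<tau>) * - x \<tau>) -
           (1 + \<alpha>) * v\<^sup>2 * \<bar>x 0\<bar> powr (2 * \<alpha>) * (inverse (u 0) * - x 0)) * 1 powr (1 + \<alpha>) = D \<tau>" .
      show ?thesis
        using DERIV_mult[OF p DERIV_diff[OF 1 2]] unfolding F_def th(1) ph1 eq .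
    qed
    show "D \<tau> > 0" if "1 - \<delta> < \<tau>" "\<tau> < 1" for \<tau>
    proof -
      have "1 - x 1 / u 1 < \<tau> - x \<tau> / u \<tau>"
        by (rule oscillator_slope_strict_decreasing[OF \<alpha> o v that(2)]) (use that in \<open>auto intro!: th1\<close>)
      then show ?thesis using \<alpha> e by (simp add: D_def)
    qed
    show "D \<tau> < 0" if "1 < \<tau>" "\<tau> < 1 + \<delta>" for \<tau>
    proof -
      have "\<tau> - x \<tau> / u \<tau> < 1 - x 1 / u 1"
        by (rule oscillator_slope_strict_decreasing[OF \<alpha> o v that(1)]) (use that in \<open>auto intro!: th1\<close>)
      then show ?thesis using \<alpha> e by (simp add: D_def mult_pos_neg)
    qed
  qed (fact \<open>\<delta> > 0\<close>)
  then obtain \<tau> a b where \<tau>: "\<bar>\<tau> - 1\<bar> < \<delta>" and ab: "a \<in> {1 - \<delta>..1 + \<delta>}" "b \<in> {1 - \<delta>..1 + \<delta>}"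
    and neq: "a \<noteq> b" and F: "F a \<tau> = F b \<tau>"
    unfolding inj_on_def by blast
  have ex: "grushin_exp \<alpha> (x 0, y\<^sub>0) (L r \<tau>) = (x \<tau>, y\<^sub>0 + F r \<tau> / ((1 + \<alpha>) * v))
      \<and> r > 0 \<and> r * x (\<phi> r) = x 0 \<and> \<theta> r \<tau> - \<phi> r > 0 \<and> L r \<tau> \<in> U"
    if "r \<in> {1 - \<delta>..1 + \<delta>}" for r
  proof -
    from good[OF that \<tau>] have g: "r > 0" "x 0 / r \<in> T0" "x \<tau> / r \<in> T1" "\<theta> r \<tau> - \<phi> r > 0" "L r \<tau> \<in> U"
      by (auto simp: good_def)
    have 1: "r * x (\<phi> r) = x 0" "r * x (\<theta> r \<tau>) = x \<tau>"
      using gT0[OF g(2)] gT1[OF g(3)] g(1) by (auto simp: \<phi>_def \<theta>_def)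
    with grushin_exp_family[OF \<alpha> o v g(1) e_def K_def, of "\<phi> r" y\<^sub>0 "\<theta> r \<tau> - \<phi> r"] g show ?thesis
      by (simp add: L_def F_def)
  qed
  have "grushin_exp \<alpha> (x 0, y\<^sub>0) (L a \<tau>) = grushin_exp \<alpha> (x 0, y\<^sub>0) (L b \<tau>)"
    using ex[OF ab(1)] ex[OF ab(2)] F by simp
  \<comment> \<open>Equal values of \<open>F\<close> on one level give equal endpoints, hence equal
    covectors by injectivity, hence equal dilations.\<close>
  then have "L a \<tau> = L b \<tau>" using inj ex[OF ab(1)] ex[OF ab(2)] unfolding inj_on_def by blast
  then have "a = b"
    using ex[OF ab(1)] ex[OF ab(2)] e unfolding L_def
    by (intro family_covector_eq_imp_dilation_eq[OF \<alpha> o v, of a b "\<theta> a \<tau> - \<phi> a" "\<theta> b \<tau> - \<phi> b" "\<phi> a" "\<phi> b"])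
      (auto simp: e_def)
  then show False using neq by simp
qed

theorem proposition13:
  fixes \<alpha> :: real and q l\<^sub>0 :: "real \<times> real" and U :: "(real \<times> real) set"
  assumes "\<alpha> \<ge> 1"
    and "l\<^sub>0 \<in> grushin_conj \<alpha> q"
    and "open U" and "l\<^sub>0 \<in> U"
  shows "\<not> inj_on (grushin_exp \<alpha> q) U"
proof -
  obtain x\<^sub>0 y\<^sub>0 u\<^sub>0 v where q: "q = (x\<^sub>0, y\<^sub>0)" and l: "l\<^sub>0 = (u\<^sub>0, v)" by (cases q, cases l\<^sub>0) auto
  show ?thesis
  proof (cases "x\<^sub>0 = 0 \<and> u\<^sub>0 = 0")
    \<comment> \<open>Here the extremal is stationary, and changing only the second component of the
      covector does not move the endpoint.\<close>
    case True
    have "\<forall>\<^sub>F t in at (0::real). (0, v + t) \<in> U"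
      by (rule topological_tendstoD[of _ "(0, v)"]) (use assms True l in \<open>auto intro!: tendsto_eq_intros\<close>)
    moreover have "\<forall>\<^sub>F t in at (0::real). t \<noteq> 0" by (simp add: eventually_at_filter)
    ultimately obtain t where "(0, v + t) \<in> U" "t \<noteq> 0"
      using eventually_happens'[OF at_neq_bot eventually_conj] by blast
    moreover have "grushin_exp \<alpha> q (0, v + t) = grushin_exp \<alpha> q l\<^sub>0"
      using True grushin_exp_stationary[OF assms(1)] by (simp add: q l)
    ultimately show ?thesis using assms(4) True unfolding inj_on_def l by force
  next
    case False
    then have v: "v \<noteq> 0" using grushin_conj_horizontal[OF assms(1)] assms(2) unfolding q l by blast
    obtain x u where xu: "x 0 = x\<^sub>0" "u 0 = u\<^sub>0" and o: "oscillator \<alpha> v x u"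
      using oscillator_exists[OF assms(1)] by blast
    \<comment> \<open>The Hamiltonian is nonzero once \<open>v \<noteq> 0\<close> and the extremal
      is not stationary, so the dilation family describes the exponential map near the
      covector.\<close>
    have "(u 0)\<^sup>2 + v\<^sup>2 * \<bar>x 0\<bar> powr (2 * \<alpha>) \<noteq> 0"
      using False v by (auto simp: xu add_nonneg_eq_0_iff)
    from grushin_conj_necessary[OF assms(1) o v refl this, of y\<^sub>0] assms(2)
    consider "u 0 = 0" "u 1 = 0" | "u 0 \<noteq> 0" "u 1 \<noteq> 0" "1 - x 1 / u 1 = 0 - x 0 / u 0"
      unfolding xu q l by auto
    then show ?thesis
    proof cases
      case 1
      then show ?thesis
        using not_inj_if_turning_points[OF assms(1) o v _ 1, of U y\<^sub>0] assms(3,4) False by (simp add: xu q l)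
    next
      case 2
      show ?thesis
        using not_inj_if_equal_slopes[OF assms(1) o v 2, of U y\<^sub>0] assms(3,4) by (simp add: xu q l)
    qed
  qed
qed

end
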